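(* Every finite simple graph $G$ has an edge-clique cover $\mathcal C$ such that, for every $v\in V(G)$, \[ \operatorname{val}_{\mathcal C}(v)\le \begin{cases} r(G), & v\text{ is universal in } G,\\ r(G)-1, & v\text{ is not universal in } G, \end{cases} \] where $r(G)=|V(G)|+1-\chi(G)$.
   Context: $\chi(G)$ is the chromatic number. A clique is a set of pairwise adjacent vertices. An edge-clique cover of $G$ is a family of cliques of $G$ such that both ends of every edge of $G$ lie together in some member of the family (for an edgeless graph the empty family is an edge-clique cover). For such a cover $\mathcal C$, the valency of a vertex $v$ is $\operatorname{val}_{\mathcal C}(v)=|\{C\in\mathcal C: v\in C\}|$. A vertex is universal if it is adjacent to every other vertex. *)

theory Defs
  imports "Graph_Theory.Graph_Theory"
begin

text \<open>
  Finite simple graphs are the symmetric, loop-free finite digraphs without parallel arcs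
  of the locale \<^locale>\<open>graph\<close>; an undirected edge \<open>uv\<close> is the pair of arcs \<open>u \<rightarrow> v\<close>, \<open>v \<rightarrow> u\<close>,
  so adjacency is \<open>u \<rightarrow>\<^bsub>G\<^esub> v\<close>.  The null graph is included.
\<close>

definition clique :: "('a, 'b) pre_digraph \<Rightarrow> 'a set \<Rightarrow> bool" where
  "clique G C \<longleftrightarrow> C \<subseteq> verts G \<and> (\<forall>u\<in>C. \<forall>v\<in>C. u \<noteq> v \<longrightarrow> u \<rightarrow>\<^bsub>G\<^esub> v)"

definition edge_clique_cover :: "('a, 'b) pre_digraph \<Rightarrow> 'a set set \<Rightarrow> bool" where
  "edge_clique_cover G \<C> \<longleftrightarrow>
     (\<forall>C\<in>\<C>. clique G C) \<and> (\<forall>u v. u \<rightarrow>\<^bsub>G\<^esub> v \<longrightarrow> (\<exists>C\<in>\<C>. u \<in> C \<and> v \<in> C))"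

definition valency :: "'a set set \<Rightarrow> 'a \<Rightarrow> nat" where
  "valency \<C> v = card {C \<in> \<C>. v \<in> C}"

definition universal_vertex :: "('a, 'b) pre_digraph \<Rightarrow> 'a \<Rightarrow> bool" where
  "universal_vertex G v \<longleftrightarrow> v \<in> verts G \<and> (\<forall>u\<in>verts G. u \<noteq> v \<longrightarrow> v \<rightarrow>\<^bsub>G\<^esub> u)"

definition proper_colouring :: "('a, 'b) pre_digraph \<Rightarrow> nat \<Rightarrow> ('a \<Rightarrow> nat) \<Rightarrow> bool" where
  "proper_colouring G k f \<longleftrightarrow>
     (\<forall>v\<in>verts G. f v < k) \<and> (\<forall>u v. u \<rightarrow>\<^bsub>G\<^esub> v \<longrightarrow> f u \<noteq> f v)"

definition chromatic_number :: "('a, 'b) pre_digraph \<Rightarrow> nat" where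
  "chromatic_number G = (LEAST k. \<exists>f. proper_colouring G k f)"

text \<open>Integer-valued, so that neither this subtraction nor \<open>r G - 1\<close> is truncated.\<close>

definition r :: "('a, 'b) pre_digraph \<Rightarrow> int" where
  "r G = int (card (verts G)) + 1 - int (chromatic_number G)"

end

theory Submission
  imports Defs
begin

text \<open>
  Write \<open>n = |V(G)|\<close>. The claim says that a vertex \<open>v\<close> lies in at most \<open>n - \<chi>(G)\<close> cliques of the
  cover, or \<open>n + 1 - \<chi>(G)\<close> if \<open>v\<close> is universal. The proof is an induction on \<open>n\<close> inside a fixed
  symmetric irreflexive relation \<open>E\<close>, the graphs of the induction being the induced subgraphs on
  finite sets \<open>A\<close> (\<open>good_cover\<close>). A set \<open>S\<close> is deleted, a cover of the rest is taken, and cliques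
  through the vertices of \<open>S\<close> are added (\<open>good_cover_extend\<close>). If deleting \<open>S\<close> lowers the chromatic
  number by at most \<open>|S| - k\<close>, then the remaining vertices may gain \<open>k\<close> new cliques each, while each
  vertex of \<open>S\<close> must be served by at most \<open>n - \<chi>(G)\<close> new cliques. For the latter the tool is the
  Nordhaus--Gaddum inequality: a set \<open>B\<close> splits into at most \<open>|B| + 1 - \<chi>(B)\<close> cliques. Hence the
  neighbours of a vertex, cut into one or two parts, can be covered cheaply, provided that
  \<open>\<chi>(G)\<close> is small compared with the chromatic numbers of the parts; this holds because
  non-neighbours of the vertex can share colours.

  If some vertex \<open>u\<close> is dominated by a non-adjacent vertex \<open>w\<close>, that is, \<open>N(u) \<subseteq> N(w)\<close>, then
  deleting \<open>u\<close> does not change \<open>\<chi>\<close>, and \<open>S = {u}\<close> works with \<open>k = 1\<close>. A complete graph is covered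
  by a single clique. In every other case two non-adjacent vertices produce four vertices
  \<open>S = {a, b, c, d}\<close> with edges \<open>ab\<close>, \<open>cd\<close> and non-edges \<open>ac\<close>, \<open>bd\<close>, \<open>ad\<close>. The colour classes
  \<open>{a, c}\<close> and \<open>{b, d}\<close> show that deleting \<open>S\<close> costs at most two colours, so \<open>k = 2\<close>: a vertex outside \<open>S\<close>
  can afford one clique towards \<open>{a, b}\<close> and one towards \<open>{c, d}\<close>.

  Two things can go wrong. First, if \<open>bc\<close> is an edge, the vertex \<open>b\<close> has to pay for one clique too
  many. This is repaired if \<open>b\<close> lies in an independent set of size three, which saves a colour
  (\<open>add_alternating_cycle\<close>); and if there is no such set anywhere and no induced pair of disjoint edges, the
  neighbours of \<open>b\<close> not adjacent to \<open>a\<close> and the neighbours of \<open>c\<close> not adjacent to \<open>d\<close> form a single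
  clique together with \<open>b\<close> and \<open>c\<close> (\<open>add_path_independence_2\<close>). Secondly, a vertex \<open>x\<close> that is
  universal outside \<open>S\<close> but not in the whole graph can afford only one new clique. Because no
  vertex is dominated, this hurts only if the non-neighbours of \<open>x\<close> are exactly \<open>b\<close> and \<open>c\<close>
  (\<open>missed_edge\<close>). Then \<open>a, b, c, d, x\<close> is an induced cycle of length five, and another path of four
  vertices on this cycle can be used instead, unless every vertex of the cycle is adjacent to all
  vertices outside; the latter situation is treated directly by \<open>add_five_cycle\<close>.
\<close>

section \<open>Valencies\<close>

lemma valency_Un_le: "valency (C \<union> D) x \<le> valency C x + valency D x"
proof -
  have "{K \<in> C \<union> D. x \<in> K} = {K \<in> C. x \<in> K} \<union> {K \<in> D. x \<in> K}" by auto
  then show ?thesis unfolding valency_def by (simp add: card_Un_le)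
qed

lemma valency_empty [simp]: "valency {} x = 0"
  by (simp add: valency_def)

lemma valency_insert_le: "valency (insert K D) x \<le> (if x \<in> K then 1 else 0) + valency D x"
proof (cases "x \<in> K")
  case True
  then have "{L \<in> insert K D. x \<in> L} = insert K {L \<in> D. x \<in> L}" by auto
  then show ?thesis unfolding valency_def using True by (simp add: card_insert_le_m1 card.insert_remove card_Diff1_le le_SucI)
next
  case False
  then have "{L \<in> insert K D. x \<in> L} = {L \<in> D. x \<in> L}" by auto
  then show ?thesis unfolding valency_def by simp
qed

lemma valency_eq_0: "(\<And>K. K \<in> D \<Longrightarrow> x \<notin> K) \<Longrightarrow> valency D x = 0"
  unfolding valency_def by (auto simp: card_eq_0_iff)

lemma valency_image_le:
  assumes "finite C" "\<And>K. K \<in> C \<Longrightarrow> x \<in> g K \<Longrightarrow> x \<in> K"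
  shows "valency (g ` C) x \<le> valency C x"
proof -
  have "{K \<in> g ` C. x \<in> K} \<subseteq> g ` {K \<in> C. x \<in> K}" using assms(2) by auto
  then have "card {K \<in> g ` C. x \<in> K} \<le> card (g ` {K \<in> C. x \<in> K})"
    by (rule card_mono[rotated]) (simp add: assms(1))
  also have "\<dots> \<le> card {K \<in> C. x \<in> K}" by (rule card_image_le) (simp add: assms(1))
  finally show ?thesis unfolding valency_def .
qed

section \<open>Chromatic numbers of induced subgraphs\<close>

locale adjacency =
  fixes E :: "'a \<Rightarrow> 'a \<Rightarrow> bool"
  assumes sym: "E u v \<Longrightarrow> E v u"
    and irrefl: "\<not> E u u"
begin

lemma E_commute: "E u v \<longleftrightarrow> E v u"
  using sym by blast

definition colourable :: "'a set \<Rightarrow> nat \<Rightarrow> bool" where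
  "colourable A m \<longleftrightarrow> (\<exists>f. (\<forall>v\<in>A. f v < m) \<and> (\<forall>u\<in>A. \<forall>v\<in>A. E u v \<longrightarrow> f u \<noteq> (f v :: nat)))"

definition chi :: "'a set \<Rightarrow> nat" where
  "chi A = (LEAST m. colourable A m)"

definition complete :: "'a set \<Rightarrow> bool" where
  "complete K \<longleftrightarrow> (\<forall>u\<in>K. \<forall>v\<in>K. u \<noteq> v \<longrightarrow> E u v)"

definition indep :: "'a set \<Rightarrow> bool" where
  "indep I \<longleftrightarrow> (\<forall>u\<in>I. \<forall>v\<in>I. \<not> E u v)"

lemma chi_le: "colourable A m \<Longrightarrow> chi A \<le> m"
  unfolding chi_def by (rule Least_le)

lemma colourable_card:
  assumes "finite A" shows "colourable A (card A)"
proof -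
  obtain f :: "'a \<Rightarrow> nat" where "bij_betw f A {0..<card A}"
    using ex_bij_betw_finite_nat[OF assms] by blast
  then have "\<forall>v\<in>A. f v < card A" "inj_on f A"
    by (auto simp: bij_betw_def)
  then show ?thesis unfolding colourable_def using irrefl by (metis inj_onD)
qed

lemma colourable_chi: "finite A \<Longrightarrow> colourable A (chi A)"
  unfolding chi_def using colourable_card by (rule LeastI)

lemma chi_le_card: "finite A \<Longrightarrow> chi A \<le> card A"
  by (simp add: chi_le colourable_card)

lemma chi_indep: "indep I \<Longrightarrow> chi I \<le> 1"
  by (rule chi_le) (auto simp: colourable_def indep_def)

lemma chi_Un:
  assumes "finite A" "finite B"
  shows "chi (A \<union> B) \<le> chi A + chi B"
proof -
  obtain f where f: "\<forall>v\<in>A. f v < chi A" "\<forall>u\<in>A. \<forall>v\<in>A. E u v \<longrightarrow> f u \<noteq> f v"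
    using colourable_chi[OF assms(1)] unfolding colourable_def by blast
  obtain g where g: "\<forall>v\<in>B. g v < chi B" "\<forall>u\<in>B. \<forall>v\<in>B. E u v \<longrightarrow> g u \<noteq> g v"
    using colourable_chi[OF assms(2)] unfolding colourable_def by blast
  define h where "h v = (if v \<in> A then f v else chi A + g v)" for v
  have "\<forall>v\<in>A \<union> B. h v < chi A + chi B"
    using f(1) g(1) by (auto simp: h_def trans_less_add1)
  moreover have "h u \<noteq> h v" if "u \<in> A \<union> B" "v \<in> A \<union> B" "E u v" for u v
  proof (cases "u \<in> A \<longleftrightarrow> v \<in> A")
    case True
    then show ?thesis using that f(2) g(2) by (auto simp: h_def)
  next
    case False
    moreover have "f x < chi A" if "x \<in> A" for x using that f(1) by blast
    ultimately show ?thesis unfolding h_def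
      by (metis not_add_less1)
  qed
  ultimately show ?thesis
    by (intro chi_le) (auto simp: colourable_def)
qed

text \<open>A vertex without neighbours in a set reuses any colour that occurs there; hence the set must
  not be empty.\<close>

lemma chi_insert_nonneighbours:
  assumes "finite B" "q \<in> B" "\<forall>x\<in>B. \<not> E d x"
  shows "chi (insert d B) \<le> chi B"
proof -
  obtain f where f: "\<forall>v\<in>B. f v < chi B" "\<forall>u\<in>B. \<forall>v\<in>B. E u v \<longrightarrow> f u \<noteq> f v"
    using colourable_chi[OF assms(1)] unfolding colourable_def by blast
  have "colourable (insert d B) (chi B)"
    unfolding colourable_def
    by (rule exI[of _ "\<lambda>v. if v = d then f q else f v"]) (use f assms in \<open>auto simp: irrefl E_commute\<close>)
  then show ?thesis by (rule chi_le)
qed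

text \<open>If \<open>N(u) \<subseteq> N(w)\<close> and \<open>u\<close>, \<open>w\<close> are not adjacent, then \<open>u\<close> can copy the colour of \<open>w\<close>.\<close>

lemma chi_remove_dominated:
  assumes "finite A" "u \<in> A" "w \<in> A" "u \<noteq> w" "\<not> E u w" "\<forall>p\<in>A. E u p \<longrightarrow> E w p"
  shows "chi A \<le> chi (A - {u})"
proof -
  obtain f where f: "\<forall>v\<in>A - {u}. f v < chi (A - {u})"
      "\<forall>x\<in>A - {u}. \<forall>v\<in>A - {u}. E x v \<longrightarrow> f x \<noteq> f v"
    using colourable_chi[of "A - {u}"] assms(1) unfolding colourable_def by blast
  have "colourable A (chi (A - {u}))"
    unfolding colourable_def
    by (rule exI[of _ "\<lambda>v. if v = u then f w else f v"])
      (use f assms in \<open>auto simp: irrefl E_commute\<close>)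
  then show ?thesis by (rule chi_le)
qed

text \<open>Use \<open>I\<close> and \<open>J\<close> as colour classes and give every other vertex a colour of its own.\<close>

lemma chi_two_indep:
  assumes "finite Z" "I \<subseteq> Z" "J \<subseteq> Z" "I \<inter> J = {}" "indep I" "indep J"
  shows "chi Z + card I + card J \<le> card Z + 2"
proof -
  have fin: "finite I" "finite J"
    using finite_subset[OF assms(2,1)] finite_subset[OF assms(3,1)] by auto
  have "chi Z = chi ((I \<union> J) \<union> (Z - (I \<union> J)))"
    using assms by (intro arg_cong[where f = chi]) auto
  also have "\<dots> \<le> chi (I \<union> J) + chi (Z - (I \<union> J))"
    using assms fin by (intro chi_Un) auto
  also have "\<dots> \<le> (chi I + chi J) + card (Z - (I \<union> J))"
    using assms fin by (intro add_mono chi_Un chi_le_card) auto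
  also have "card (Z - (I \<union> J)) = card Z - (card I + card J)"
    using assms fin by (simp add: card_Diff_subset card_Un_disjoint)
  finally have "chi Z \<le> chi I + chi J + (card Z - (card I + card J))" .
  moreover have "card I + card J \<le> card Z"
    using card_mono[of Z "I \<union> J"] assms fin by (simp add: card_Un_disjoint)
  moreover have "chi I \<le> 1" "chi J \<le> 1" using chi_indep[OF assms(5)] chi_indep[OF assms(6)] .
  ultimately show ?thesis by linarith
qed

lemma chi_one_indep:
  assumes "finite Z" "I \<subseteq> Z" "indep I"
  shows "chi Z + card I \<le> card Z + 1"
proof -
  have fin: "finite I" using finite_subset[OF assms(2,1)] .
  have "chi Z = chi (I \<union> (Z - I))" using assms by (intro arg_cong[where f = chi]) auto
  also have "\<dots> \<le> chi I + card (Z - I)"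
    using chi_Un[of I "Z - I"] chi_le_card[of "Z - I"] assms(1) fin by simp
  finally have "chi Z \<le> 1 + (card Z - card I)"
    using chi_indep[OF assms(3)] fin assms(2) by (simp add: card_Diff_subset)
  moreover have "card I \<le> card Z" using card_mono assms by blast
  ultimately show ?thesis by simp
qed

lemma chi_split_diff:
  assumes "finite A" "P \<subseteq> A"
  shows "chi A \<le> chi P + chi (A - P)" "card A = card P + card (A - P)"
proof -
  have "finite P" using assms finite_subset by auto
  moreover have "A = P \<union> (A - P)" using assms by auto
  ultimately show "chi A \<le> chi P + chi (A - P)" using chi_Un[of P "A - P"] assms by auto
  show "card A = card P + card (A - P)"
    using card_mono[OF assms] \<open>finite P\<close> assms by (simp add: card_Diff_subset)
qed

section \<open>Covering the neighbours of a vertex or an edge\<close>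

text \<open>
  This is the Nordhaus--Gaddum inequality, the map \<open>g\<close> being a partition of \<open>A\<close> into \<open>k\<close> cliques.
  Insert the vertices one by one. The sum \<open>k + \<chi>\<close> grows by two only if the new vertex has a
  non-neighbour in each of the \<open>k\<close> cliques and a neighbour in each of the \<open>\<chi>\<close> colour classes. In that
  case \<open>k + \<chi> \<le> |A|\<close>, so there was room. The condition \<open>k \<ge> 1\<close> costs nothing and guarantees a clique
  even when \<open>A\<close> is empty.
\<close>

theorem nordhaus_gaddum:
  assumes "finite A"
  shows "\<exists>k\<ge>1. \<exists>g. (\<forall>v\<in>A. g v < k) \<and> (\<forall>u\<in>A. \<forall>v\<in>A. u \<noteq> v \<longrightarrow> g u = (g v :: nat) \<longrightarrow> E u v)
    \<and> k + chi A \<le> card A + 1"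
  using assms
proof (induction A rule: finite_induct)
  case empty
  have "chi {} = 0" using chi_le_card[of "{}"] by simp
  then show ?case by (intro exI[of _ 1]) auto
next
  case (insert v A)
  then obtain k g where k: "k \<ge> 1" and g: "\<forall>x\<in>A. g x < k"
      "\<forall>x\<in>A. \<forall>y\<in>A. x \<noteq> y \<longrightarrow> g x = g y \<longrightarrow> E x y"
    and sum: "k + chi A \<le> card A + 1" by blast
  have ca: "card (insert v A) = card A + 1" using insert by simp
  have c1: "chi (insert v A) \<le> chi A + 1"
    using chi_Un[of A "{v}"] chi_indep[of "{v}"] irrefl insert by (simp add: indep_def)
  have new: "\<exists>g'. (\<forall>x\<in>insert v A. g' x < k + 1) \<and>
      (\<forall>x\<in>insert v A. \<forall>y\<in>insert v A. x \<noteq> y \<longrightarrow> g' x = (g' y::nat) \<longrightarrow> E x y)"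
    by (rule exI[of _ "g(v := k)"]) (use g insert(2) in \<open>auto simp: less_SucI\<close>)
  show ?case
  proof (cases "\<exists>i<k. \<forall>x\<in>A. g x = i \<longrightarrow> E v x")
    case True
    then obtain i where i: "i < k" "\<forall>x\<in>A. g x = i \<longrightarrow> E v x" by blast
    have "\<forall>x\<in>insert v A. (g(v := i)) x < k"
      "\<forall>x\<in>insert v A. \<forall>y\<in>insert v A. x \<noteq> y \<longrightarrow> (g(v := i)) x = (g(v := i)) y \<longrightarrow> E x y"
      using g i by (auto simp: E_commute)
    moreover have "k + chi (insert v A) \<le> card (insert v A) + 1" using sum c1 ca by simp
    ultimately show ?thesis using k by (intro exI[of _ k] conjI exI[of _ "g(v := i)"])
  next
    case False
    then have "\<forall>i<k. \<exists>x\<in>A. g x = i \<and> \<not> E v x" by blast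
    then have "{..<k} \<subseteq> g ` {x \<in> A. \<not> E v x}" by force
    then have kle: "k \<le> card {x \<in> A. \<not> E v x}"
      using surj_card_le[of "{x \<in> A. \<not> E v x}" "{..<k}" g] insert(1) by simp
    show ?thesis
    proof (cases "chi (insert v A) \<le> chi A")
      case True
      then show ?thesis using new k sum ca by (intro exI[of _ "k + 1"]) auto
    next
      case False
      obtain f where f: "\<forall>x\<in>A. f x < chi A" "\<forall>x\<in>A. \<forall>y\<in>A. E x y \<longrightarrow> f x \<noteq> f y"
        using colourable_chi[OF insert(1)] unfolding colourable_def by blast
      have "\<exists>x\<in>A. f x = i \<and> E v x" if i: "i < chi A" for i
      proof (rule ccontr)
        assume "\<not> ?thesis"
        then have "colourable (insert v A) (chi A)"
          unfolding colourable_def using f i insert(2)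
          by (intro exI[of _ "f(v := i)"]) (auto simp: irrefl E_commute)
        then show False using False chi_le by blast
      qed
      then have "{..<chi A} \<subseteq> f ` {x \<in> A. E v x}" by force
      then have cle: "chi A \<le> card {x \<in> A. E v x}"
        using surj_card_le[of "{x \<in> A. E v x}" "{..<chi A}" f] insert(1) by simp
      have "card {x \<in> A. E v x} + card {x \<in> A. \<not> E v x} = card A"
        using insert(1) by (subst card_Un_disjoint[symmetric]) (auto intro: arg_cong[where f = card])
      then have "k + chi A \<le> card A" using kle cle by simp
      then show ?thesis using new k c1 ca by (intro exI[of _ "k + 1"]) auto
    qed
  qed
qed

text \<open>Adding the clique \<open>T\<close> to each part of a Nordhaus--Gaddum clique partition of \<open>A\<close> covers all edges
  between \<open>A\<close> and \<open>T\<close>, and those in \<open>T\<close>, while every vertex of \<open>A\<close> is used just once.\<close>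

lemma star_family:
  assumes "finite A" "complete T" "A \<inter> T = {}" "\<forall>x\<in>A. \<forall>t\<in>T. E x t"
  obtains D where "\<forall>K\<in>D. K \<subseteq> A \<union> T \<and> complete K"
    and "\<forall>x\<in>A \<union> T. \<forall>t\<in>T. \<exists>K\<in>D. x \<in> K \<and> t \<in> K"
    and "\<forall>x\<in>A. valency D x \<le> 1"
    and "\<forall>x. x \<notin> A \<union> T \<longrightarrow> valency D x = 0"
    and "\<forall>x. valency D x + chi A \<le> card A + 1"
proof -
  obtain k g where k: "k \<ge> 1" and g: "\<forall>v\<in>A. g v < k"
      "\<forall>u\<in>A. \<forall>v\<in>A. u \<noteq> v \<longrightarrow> g u = g v \<longrightarrow> E u v"
    and sum: "k + chi A \<le> card A + 1"
    using nordhaus_gaddum[OF assms(1)] by blast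
  define h where "h i = {x \<in> A. g x = i} \<union> T" for i
  define D where "D = h ` {..<k}"
  have "\<forall>K\<in>D. K \<subseteq> A \<union> T \<and> complete K"
    using assms g by (auto simp: D_def h_def complete_def intro: sym)
  moreover have "\<forall>x\<in>A \<union> T. \<forall>t\<in>T. \<exists>K\<in>D. x \<in> K \<and> t \<in> K"
  proof (intro ballI)
    fix x t assume x: "x \<in> A \<union> T" and t: "t \<in> T"
    show "\<exists>K\<in>D. x \<in> K \<and> t \<in> K"
    proof (cases "x \<in> A")
      case True
      then show ?thesis using t g by (intro bexI[of _ "h (g x)"]) (auto simp: D_def h_def)
    next
      case False
      then show ?thesis using x t k by (intro bexI[of _ "h 0"]) (auto simp: D_def h_def)
    qed
  qed
  moreover have "\<forall>x\<in>A. valency D x \<le> 1"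
  proof
    fix x assume "x \<in> A"
    then have "{K \<in> D. x \<in> K} \<subseteq> {h (g x)}" using assms(3) by (auto simp: D_def h_def)
    then show "valency D x \<le> 1" unfolding valency_def using card_mono[of "{h (g x)}"] by fastforce
  qed
  moreover have "\<forall>x. x \<notin> A \<union> T \<longrightarrow> valency D x = 0"
    by (auto intro!: valency_eq_0 simp: D_def h_def)
  moreover have "\<forall>x. valency D x + chi A \<le> card A + 1"
  proof
    fix x
    have "valency D x \<le> card D" unfolding valency_def by (rule card_mono) (auto simp: D_def)
    also have "\<dots> \<le> k" unfolding D_def using card_image_le[of "{..<k}" h] by simp
    finally show "valency D x + chi A \<le> card A + 1" using sum by simp
  qed
  ultimately show ?thesis using that by blast
qed

text \<open>The edge \<open>vw\<close> can be attached to \<open>X\<close> in such a way that each vertex of \<open>X\<close> is used only once: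
  the common neighbours get cliques containing both \<open>v\<close> and \<open>w\<close>, the private neighbours of each end
  get cliques of their own. Each end pays for two Nordhaus--Gaddum partitions, whence the summand 2.\<close>

lemma pair_family:
  assumes "finite X" "E v w" "v \<notin> X" "w \<notin> X"
  obtains D where "\<forall>K\<in>D. K \<subseteq> X \<union> {v, w} \<and> complete K"
    and "\<forall>s\<in>{v, w}. \<forall>u\<in>X \<union> {v, w}. E s u \<longrightarrow> (\<exists>K\<in>D. s \<in> K \<and> u \<in> K)"
    and "\<forall>x\<in>X. valency D x \<le> 1"
    and "\<forall>x\<in>X. \<not> E v x \<longrightarrow> \<not> E w x \<longrightarrow> valency D x = 0"
    and "valency D v + chi {x\<in>X. E v x \<and> E w x} + chi {x\<in>X. E v x \<and> \<not> E w x}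
      \<le> card {x\<in>X. E v x \<and> E w x} + card {x\<in>X. E v x \<and> \<not> E w x} + 2"
    and "valency D w + chi {x\<in>X. E v x \<and> E w x} + chi {x\<in>X. E w x \<and> \<not> E v x}
      \<le> card {x\<in>X. E v x \<and> E w x} + card {x\<in>X. E w x \<and> \<not> E v x} + 2"
proof -
  define P where "P = {x\<in>X. E v x \<and> E w x}"
  define Q where "Q = {x\<in>X. E v x \<and> \<not> E w x}"
  define R where "R = {x\<in>X. E w x \<and> \<not> E v x}"
  have vw: "v \<noteq> w" using assms(2) irrefl by auto
  obtain DP where DP: "\<forall>K\<in>DP. K \<subseteq> P \<union> {v, w} \<and> complete K"
    "\<forall>x\<in>P \<union> {v, w}. \<forall>t\<in>{v, w}. \<exists>K\<in>DP. x \<in> K \<and> t \<in> K"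
    "\<forall>x\<in>P. valency DP x \<le> 1" "\<forall>x. x \<notin> P \<union> {v, w} \<longrightarrow> valency DP x = 0"
    "\<forall>x. valency DP x + chi P \<le> card P + 1"
    by (rule star_family[of P "{v, w}"]) (use assms in \<open>auto simp: P_def complete_def E_commute\<close>)
  obtain DQ where DQ: "\<forall>K\<in>DQ. K \<subseteq> Q \<union> {v} \<and> complete K"
    "\<forall>x\<in>Q \<union> {v}. \<forall>t\<in>{v}. \<exists>K\<in>DQ. x \<in> K \<and> t \<in> K"
    "\<forall>x\<in>Q. valency DQ x \<le> 1" "\<forall>x. x \<notin> Q \<union> {v} \<longrightarrow> valency DQ x = 0"
    "\<forall>x. valency DQ x + chi Q \<le> card Q + 1"
    by (rule star_family[of Q "{v}"]) (use assms in \<open>auto simp: Q_def complete_def E_commute\<close>)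
  obtain DR where DR: "\<forall>K\<in>DR. K \<subseteq> R \<union> {w} \<and> complete K"
    "\<forall>x\<in>R \<union> {w}. \<forall>t\<in>{w}. \<exists>K\<in>DR. x \<in> K \<and> t \<in> K"
    "\<forall>x\<in>R. valency DR x \<le> 1" "\<forall>x. x \<notin> R \<union> {w} \<longrightarrow> valency DR x = 0"
    "\<forall>x. valency DR x + chi R \<le> card R + 1"
    by (rule star_family[of R "{w}"]) (use assms in \<open>auto simp: R_def complete_def E_commute\<close>)
  define D where "D = DP \<union> (DQ \<union> DR)"
  have val: "valency D x \<le> valency DP x + (valency DQ x + valency DR x)" for x
    unfolding D_def
    by (rule order_trans[OF valency_Un_le add_left_mono[OF valency_Un_le]])
  have nbr: "\<exists>K\<in>D. s \<in> K \<and> u \<in> K" if "s \<in> {v, w}" "u \<in> X \<union> {v, w}" "E s u" for s u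
  proof (cases "u \<in> P \<union> {v, w}")
    case True
    then have "\<exists>K\<in>DP. u \<in> K \<and> s \<in> K" using DP(2) \<open>s \<in> {v, w}\<close> by blast
    then show ?thesis unfolding D_def by blast
  next
    case False
    then consider "s = v" "u \<in> Q" | "s = w" "u \<in> R"
      using \<open>s \<in> {v, w}\<close> \<open>u \<in> X \<union> {v, w}\<close> \<open>E s u\<close> False unfolding P_def Q_def R_def by blast
    then show ?thesis
    proof cases
      case 1
      then have "\<exists>K\<in>DQ. u \<in> K \<and> v \<in> K" using DQ(2) by blast
      then show ?thesis using 1 unfolding D_def by blast
    next
      case 2
      then have "\<exists>K\<in>DR. u \<in> K \<and> w \<in> K" using DR(2) by blast
      then show ?thesis using 2 unfolding D_def by blast
    qed
  qed
  show ?thesis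
  proof (rule that[of D])
    show "\<forall>K\<in>D. K \<subseteq> X \<union> {v, w} \<and> complete K"
    proof
      fix K assume "K \<in> D"
      then consider "K \<in> DP" | "K \<in> DQ" | "K \<in> DR" unfolding D_def by blast
      moreover have "P \<subseteq> X" "Q \<subseteq> X" "R \<subseteq> X" by (auto simp: P_def Q_def R_def)
      ultimately show "K \<subseteq> X \<union> {v, w} \<and> complete K"
        using DP(1)[rule_format, of K] DQ(1)[rule_format, of K] DR(1)[rule_format, of K]
        by cases auto
    qed
    show "\<forall>s\<in>{v, w}. \<forall>u\<in>X \<union> {v, w}. E s u \<longrightarrow> (\<exists>K\<in>D. s \<in> K \<and> u \<in> K)"
      using nbr by blast
    show "\<forall>x\<in>X. valency D x \<le> 1"
    proof
      fix x assume x: "x \<in> X"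
      then have n: "x \<noteq> v" "x \<noteq> w" using assms by auto
      consider "x \<in> P" "x \<notin> Q" "x \<notin> R" | "x \<in> Q" "x \<notin> P" "x \<notin> R" | "x \<in> R" "x \<notin> P" "x \<notin> Q"
        | "x \<notin> P" "x \<notin> Q" "x \<notin> R" by (auto simp: P_def Q_def R_def)
      then show "valency D x \<le> 1"
        using val[of x] DP(3,4) DQ(3,4) DR(3,4) n by cases auto
    qed
    show "\<forall>x\<in>X. \<not> E v x \<longrightarrow> \<not> E w x \<longrightarrow> valency D x = 0"
    proof (intro ballI impI)
      fix x assume "x \<in> X" "\<not> E v x" "\<not> E w x"
      then have "x \<notin> P \<union> {v, w}" "x \<notin> Q \<union> {v}" "x \<notin> R \<union> {w}"
        using assms by (auto simp: P_def Q_def R_def)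
      then show "valency D x = 0" using val[of x] DP(4) DQ(4) DR(4) by simp
    qed
    have "v \<notin> R \<union> {w}" "w \<notin> Q \<union> {v}" using assms vw by (auto simp: R_def Q_def)
    then have "valency D v \<le> valency DP v + valency DQ v"
      "valency D w \<le> valency DP w + valency DR w"
      using val[of v] val[of w] DR(4) DQ(4) by auto
    then show "valency D v + chi {x\<in>X. E v x \<and> E w x} + chi {x\<in>X. E v x \<and> \<not> E w x}
      \<le> card {x\<in>X. E v x \<and> E w x} + card {x\<in>X. E v x \<and> \<not> E w x} + 2"
     "valency D w + chi {x\<in>X. E v x \<and> E w x} + chi {x\<in>X. E w x \<and> \<not> E v x}
      \<le> card {x\<in>X. E v x \<and> E w x} + card {x\<in>X. E w x \<and> \<not> E v x} + 2"
      unfolding P_def[symmetric] Q_def[symmetric] R_def[symmetric]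
      using DP(5)[rule_format, of v] DQ(5)[rule_format, of v] DP(5)[rule_format, of w] DR(5)[rule_format, of w]
      by linarith+
  qed
qed

text \<open>
  A vertex whose neighbours in \<open>P\<close> and \<open>Q\<close> have been covered by Nordhaus--Gaddum partitions exceeds
  \<open>|P| + |Q| - \<chi>(P) - \<chi>(Q)\<close> by some small \<open>j\<close>. This excess is admissible if the other vertices,
  which are essentially its non-neighbours, can be coloured so that \<open>j\<close> colours are saved.
\<close>

lemma valency_budget:
  assumes "finite A" "P \<subseteq> A" "Q \<subseteq> A" "P \<inter> Q = {}"
    and "val + chi P + chi Q \<le> card P + card Q + j"
    and "chi (A - P - Q) + j \<le> card (A - P - Q)"
  shows "val + chi A \<le> card A"
proof -
  have "finite (A - P)" "Q \<subseteq> A - P" using assms by auto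
  then show ?thesis
    using chi_split_diff[OF assms(1,2)] chi_split_diff[of "A - P" Q] assms(5,6) by linarith
qed

section \<open>Extending a cover of an induced subgraph\<close>

definition universal_in :: "'a set \<Rightarrow> 'a \<Rightarrow> bool" where
  "universal_in A v \<longleftrightarrow> (\<forall>u\<in>A. u \<noteq> v \<longrightarrow> E v u)"

definition clique_cover :: "'a set \<Rightarrow> 'a set set \<Rightarrow> bool" where
  "clique_cover A C \<longleftrightarrow> (\<forall>K\<in>C. K \<subseteq> A \<and> complete K) \<and>
    (\<forall>u\<in>A. \<forall>v\<in>A. E u v \<longrightarrow> (\<exists>K\<in>C. u \<in> K \<and> v \<in> K))"

definition good_cover :: "'a set \<Rightarrow> 'a set set \<Rightarrow> bool" where
  "good_cover A C \<longleftrightarrow> clique_cover A C \<and>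
    (\<forall>v\<in>A. valency C v + chi A \<le> card A + (if universal_in A v then 1 else 0))"

definition undominated :: "'a set \<Rightarrow> bool" where
  "undominated A \<longleftrightarrow> (\<forall>u\<in>A. \<forall>w\<in>A. u \<noteq> w \<longrightarrow> \<not> E u w \<longrightarrow> (\<exists>p\<in>A. E u p \<and> \<not> E w p))"

definition misses_exactly :: "'a set \<Rightarrow> 'a \<Rightarrow> 'a \<Rightarrow> 'a \<Rightarrow> bool" where
  "misses_exactly A b c x \<longleftrightarrow> x \<in> A \<and> x \<noteq> b \<and> x \<noteq> c \<and> \<not> E x b \<and> \<not> E x c \<and>
    (\<forall>y\<in>A. y \<noteq> x \<longrightarrow> y \<noteq> b \<longrightarrow> y \<noteq> c \<longrightarrow> E x y)"

text \<open>
  Deleting \<open>S\<close> lowers the bound for the other vertices by at least \<open>k\<close>, which is what \<open>D\<close> may use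
  up. The condition \<open>defect\<close> concerns a vertex that is universal only after the deletion: it loses the
  bonus of universal vertices, so \<open>D\<close> may use it less than \<open>k\<close> times.
\<close>

lemma good_cover_extend:
  assumes "S \<subseteq> A" "good_cover (A - S) C"
    and D: "\<forall>K\<in>D. K \<subseteq> A \<and> complete K"
    and cov: "\<forall>s\<in>S. \<forall>u\<in>A. E s u \<longrightarrow> (\<exists>K\<in>D. s \<in> K \<and> u \<in> K)"
    and chi: "chi A + k \<le> chi (A - S) + card S"
    and card: "card A = card (A - S) + card S"
    and new: "\<forall>s\<in>S. valency D s + chi A \<le> card A"
    and old: "\<forall>x\<in>A - S. valency D x \<le> k"
    and defect: "\<forall>x\<in>A - S. universal_in (A - S) x \<longrightarrow> \<not> universal_in A x \<longrightarrow> valency D x < k"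
  shows "good_cover A (C \<union> D)"
proof -
  have C: "\<forall>K\<in>C. K \<subseteq> A - S \<and> complete K"
    "\<forall>u\<in>A - S. \<forall>v\<in>A - S. E u v \<longrightarrow> (\<exists>K\<in>C. u \<in> K \<and> v \<in> K)"
    and valC: "\<forall>v\<in>A - S. valency C v + chi (A - S) \<le> card (A - S) + (if universal_in (A - S) v then 1 else 0)"
    using assms(2) unfolding good_cover_def clique_cover_def by blast+
  have "\<exists>K\<in>C \<union> D. u \<in> K \<and> v \<in> K" if uv: "u \<in> A" "v \<in> A" "E u v" for u v
  proof -
    consider "u \<in> S" | "v \<in> S" | "u \<in> A - S" "v \<in> A - S" using uv by blast
    then show ?thesis
    proof cases
      case 1
      then show ?thesis using cov uv by blast
    next
      case 2
      then have "\<exists>K\<in>D. v \<in> K \<and> u \<in> K" using cov uv sym[OF uv(3)] by blast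
      then show ?thesis by blast
    next
      case 3
      then show ?thesis using C(2) uv by blast
    qed
  qed
  then have "clique_cover A (C \<union> D)" using C(1) D unfolding clique_cover_def by blast
  moreover have "valency (C \<union> D) x + chi A \<le> card A + (if universal_in A x then 1 else 0)"
    if x: "x \<in> A" for x
  proof (cases "x \<in> S")
    case True
    then have "valency C x = 0" using C(1) by (intro valency_eq_0) blast
    then show ?thesis using valency_Un_le[of C D x] new True by fastforce
  next
    case False
    then have xA: "x \<in> A - S" using x by blast
    have v: "valency (C \<union> D) x \<le> valency C x + valency D x" by (rule valency_Un_le)
    have c: "valency C x + chi (A - S) \<le> card (A - S) + (if universal_in (A - S) x then 1 else 0)"
      using valC xA by blast
    have d: "valency D x \<le> k" using old xA by blast
    show ?thesis
    proof (cases "universal_in (A - S) x \<and> \<not> universal_in A x")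
      case True
      then have "valency D x < k" using defect xA by blast
      then show ?thesis using v c chi card True by simp
    next
      case False
      moreover have "universal_in A x \<Longrightarrow> universal_in (A - S) x"
        by (simp add: universal_in_def)
      ultimately show ?thesis using v c d chi card by (cases "universal_in A x") auto
    qed
  qed
  ultimately show ?thesis unfolding good_cover_def by blast
qed

text \<open>Since \<open>u\<close> and \<open>w\<close> may share a colour, \<open>u\<close> can afford the Nordhaus--Gaddum partition of
  its neighbourhood.\<close>

lemma add_dominated_vertex:
  assumes "finite A" "u \<in> A" "w \<in> A" "u \<noteq> w" "\<not> E u w" "\<forall>p\<in>A. E u p \<longrightarrow> E w p"
    and "good_cover (A - {u}) C"
  shows "\<exists>C'. good_cover A C'"
proof -
  define N where "N = {x \<in> A. E u x}"
  obtain D where D: "\<forall>K\<in>D. K \<subseteq> N \<union> {u} \<and> complete K"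
    "\<forall>x\<in>N \<union> {u}. \<forall>t\<in>{u}. \<exists>K\<in>D. x \<in> K \<and> t \<in> K"
    "\<forall>x\<in>N. valency D x \<le> 1" "\<forall>x. x \<notin> N \<union> {u} \<longrightarrow> valency D x = 0"
    "\<forall>x. valency D x + chi N \<le> card N + 1"
    by (rule star_family[of N "{u}"])
      (use assms in \<open>auto simp: N_def complete_def irrefl intro: sym\<close>)
  have "good_cover A (C \<union> D)"
  proof (rule good_cover_extend[where S = "{u}" and k = 1])
    show "{u} \<subseteq> A" "good_cover (A - {u}) C" using assms by auto
    show "\<forall>K\<in>D. K \<subseteq> A \<and> complete K" using D(1) assms(2) unfolding N_def by blast
    show "\<forall>s\<in>{u}. \<forall>v\<in>A. E s v \<longrightarrow> (\<exists>K\<in>D. s \<in> K \<and> v \<in> K)"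
      using D(2) unfolding N_def by blast
    show "chi A + 1 \<le> chi (A - {u}) + card {u}"
      using chi_remove_dominated[OF assms(1-6)] by simp
    show "card A = card (A - {u}) + card {u}"
      using card_Suc_Diff1[OF assms(1,2)] by simp
    have "valency D u + chi A \<le> card A"
    proof (rule valency_budget[where P = N and Q = "{}" and j = 1])
      show "valency D u + chi N + chi {} \<le> card N + card {} + 1"
        using D(5)[rule_format, of u] chi_le_card[of "{}"] by simp
      have "chi (A - N) + card {u, w} \<le> card (A - N) + 1"
        by (rule chi_one_indep)
          (use assms in \<open>auto simp: N_def indep_def irrefl E_commute\<close>)
      then show "chi (A - N - {}) + 1 \<le> card (A - N - {})" using assms(4) by simp
    qed (use assms(1) in \<open>auto simp: N_def\<close>)
    then show "\<forall>s\<in>{u}. valency D s + chi A \<le> card A" by simp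
    show "\<forall>x\<in>A - {u}. valency D x \<le> 1" using D(3,4) by fastforce
    show "\<forall>x\<in>A - {u}. universal_in (A - {u}) x \<longrightarrow> \<not> universal_in A x \<longrightarrow> valency D x < 1"
    proof (intro ballI impI)
      fix x assume "x \<in> A - {u}" "universal_in (A - {u}) x" "\<not> universal_in A x"
      then have "x \<notin> N \<union> {u}" by (auto simp: universal_in_def N_def E_commute)
      then show "valency D x < 1" using D(4) by simp
    qed
  qed
  then show ?thesis by blast
qed

section \<open>Attaching four vertices\<close>

text \<open>
  The configuration used from here on consists of the edges \<open>ab\<close>, \<open>cd\<close> and the non-edges \<open>ac\<close>, \<open>bd\<close>,
  \<open>ad\<close>. If \<open>bc\<close> is an edge this is an induced path \<open>a b c d\<close>, otherwise an induced \<open>2K\<^sub>2\<close>. The two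
  independent pairs \<open>{a, c}\<close> and \<open>{b, d}\<close> save two colours.
\<close>

lemma four_vertex_counts:
  assumes "finite A" "{a, b, c, d} \<subseteq> A" "E a b" "E c d" "\<not> E a c" "\<not> E b d" "\<not> E a d"
  shows "card {a, b, c, d} = 4" "a \<noteq> b" "a \<noteq> c" "a \<noteq> d" "b \<noteq> c" "b \<noteq> d" "c \<noteq> d"
    and "chi A + 2 \<le> chi (A - {a, b, c, d}) + card {a, b, c, d}"
    and "card A = card (A - {a, b, c, d}) + card {a, b, c, d}"
    and "indep {a, c}" "indep {b, d}"
    and "\<And>Z. finite Z \<Longrightarrow> {a, b, c, d} \<subseteq> Z \<Longrightarrow> chi Z + 2 \<le> card Z"
proof -
  show ne: "a \<noteq> b" "a \<noteq> c" "a \<noteq> d" "b \<noteq> c" "b \<noteq> d" "c \<noteq> d"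
    using assms irrefl sym by metis+
  then show c4: "card {a, b, c, d} = 4" by simp
  show ind: "indep {a, c}" "indep {b, d}" using assms by (auto simp: indep_def irrefl E_commute)
  show Z: "chi Z + 2 \<le> card Z" if "finite Z" "{a, b, c, d} \<subseteq> Z" for Z
    using chi_two_indep[OF that(1), of "{a, c}" "{b, d}"] that(2) ind ne by auto
  show "card A = card (A - {a, b, c, d}) + card {a, b, c, d}"
    using chi_split_diff(2)[OF assms(1,2)] by linarith
  show "chi A + 2 \<le> chi (A - {a, b, c, d}) + card {a, b, c, d}"
    using chi_split_diff(1)[OF assms(1,2)] Z[of "{a, b, c, d}"] c4 by simp
qed

text \<open>
  Let \<open>x\<close> be universal outside the four vertices but miss one of them, say \<open>s\<close>. As \<open>x\<close> does not
  dominate \<open>s\<close>, some neighbour \<open>p\<close> of \<open>s\<close> is missed by \<open>x\<close> as well, and \<open>p\<close> is also one of the four.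
  So \<open>x\<close> misses both ends of an edge, and the edge \<open>bc\<close> is ruled out unless another edge is missed too.
\<close>

lemma missed_edge:
  assumes "undominated A" "{a, b, c, d} \<subseteq> A" "\<not> E a c" "\<not> E b d" "\<not> E a d"
    and ex: "E b c \<longrightarrow> \<not> misses_exactly A b c x"
    and x: "x \<in> A - {a, b, c, d}" "universal_in (A - {a, b, c, d}) x" "\<not> universal_in A x"
  shows "(\<not> E x a \<and> \<not> E x b) \<or> (\<not> E x c \<and> \<not> E x d)"
proof (rule ccontr)
  assume neg: "\<not> ?thesis"
  have out: "E x y" if "y \<in> A" "y \<notin> {a, b, c, d}" "y \<noteq> x" for y
    using x(2) that unfolding universal_in_def by blast
  obtain s where s: "s \<in> A" "s \<noteq> x" "\<not> E x s"
    using x(3) unfolding universal_in_def by blast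
  then have sS: "s \<in> {a, b, c, d}" using out by blast
  have "x \<in> A" using x by blast
  then obtain p where p: "p \<in> A" "E s p" "\<not> E x p"
    using assms(1) s E_commute unfolding undominated_def by metis
  have "p \<noteq> x" using p s E_commute by blast
  then have pS: "p \<in> {a, b, c, d}" using out p by blast
  have "\<not> E c a" "\<not> E d b" "\<not> E d a" using assms E_commute by blast+
  then have bc: "E b c" "\<not> E x b" "\<not> E x c"
    using sS pS p(2,3) s(3) neg assms(3-5) irrefl E_commute by blast+
  then have "E x a" "E x d" using neg by blast+
  then have "misses_exactly A b c x"
    unfolding misses_exactly_def using bc x(1) out by blast
  then show False using ex bc by blast
qed

text \<open>
  The edge \<open>ab\<close> is attached to the rest, and then \<open>cd\<close> is attached to the result. In the second step \<open>b\<close>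
  is used once more if \<open>bc\<close> is an edge. Then \<open>b\<close> needs three colours to be saved outside its
  neighbourhood in the rest: the colour classes \<open>{a, c}\<close> and \<open>{b, y, z}\<close> do so.
\<close>

lemma add_alternating_cycle:
  assumes A: "finite A" "{a, b, c, d} \<subseteq> A" "E a b" "E c d" "\<not> E a c" "\<not> E b d" "\<not> E a d"
    and und: "undominated A"
    and C: "good_cover (A - {a, b, c, d}) C"
    and bc: "E b c \<Longrightarrow> (\<exists>y\<in>A. \<exists>z\<in>A. y \<noteq> z \<and> y \<noteq> b \<and> z \<noteq> b \<and> indep {b, y, z})
      \<and> \<not> (\<exists>x. misses_exactly A b c x)"
  shows "\<exists>C'. good_cover A C'"
proof -
  define S where "S = {a, b, c, d}"
  note cnt = four_vertex_counts[OF A]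
  note ne = cnt(2-7)
  define X where "X = A - S"
  define Y where "Y = A - {c, d}"
  have Y: "Y = X \<union> {a, b}" using A(2) ne by (auto simp: X_def Y_def S_def)
  have fin: "finite X" "finite Y" using A(1) by (auto simp: X_def Y_def)
  define P1 where "P1 = {x\<in>X. E a x \<and> E b x}"
  define Qa where "Qa = {x\<in>X. E a x \<and> \<not> E b x}"
  define Qb where "Qb = {x\<in>X. E b x \<and> \<not> E a x}"
  define P2 where "P2 = {x\<in>Y. E c x \<and> E d x}"
  define Qc where "Qc = {x\<in>Y. E c x \<and> \<not> E d x}"
  define Qd where "Qd = {x\<in>Y. E d x \<and> \<not> E c x}"
  have subs: "P1 \<subseteq> A" "Qa \<subseteq> A" "Qb \<subseteq> A" "P2 \<subseteq> A" "Qc \<subseteq> A" "Qd \<subseteq> A"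
    by (auto simp: P1_def Qa_def Qb_def P2_def Qc_def Qd_def X_def Y_def)
  obtain D1 where D1: "\<forall>K\<in>D1. K \<subseteq> X \<union> {a, b} \<and> complete K"
    "\<forall>s\<in>{a, b}. \<forall>u\<in>X \<union> {a, b}. E s u \<longrightarrow> (\<exists>K\<in>D1. s \<in> K \<and> u \<in> K)"
    "\<forall>x\<in>X. valency D1 x \<le> 1" "\<forall>x\<in>X. \<not> E a x \<longrightarrow> \<not> E b x \<longrightarrow> valency D1 x = 0"
    "valency D1 a + chi P1 + chi Qa \<le> card P1 + card Qa + 2"
    "valency D1 b + chi P1 + chi Qb \<le> card P1 + card Qb + 2"
    unfolding P1_def Qa_def Qb_def
    by (rule pair_family[OF fin(1) A(3)]) (auto simp: X_def S_def)
  obtain D2 where D2: "\<forall>K\<in>D2. K \<subseteq> Y \<union> {c, d} \<and> complete K"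
    "\<forall>s\<in>{c, d}. \<forall>u\<in>Y \<union> {c, d}. E s u \<longrightarrow> (\<exists>K\<in>D2. s \<in> K \<and> u \<in> K)"
    "\<forall>x\<in>Y. valency D2 x \<le> 1" "\<forall>x\<in>Y. \<not> E c x \<longrightarrow> \<not> E d x \<longrightarrow> valency D2 x = 0"
    "valency D2 c + chi P2 + chi Qc \<le> card P2 + card Qc + 2"
    "valency D2 d + chi P2 + chi Qd \<le> card P2 + card Qd + 2"
    unfolding P2_def Qc_def Qd_def
    by (rule pair_family[OF fin(2) A(4)]) (auto simp: Y_def)
  define D where "D = D1 \<union> D2"
  have val: "valency D x \<le> valency D1 x + valency D2 x" for x
    unfolding D_def by (rule valency_Un_le)
  have out1: "valency D1 c = 0" "valency D1 d = 0"
    by (rule valency_eq_0; use D1(1) ne in \<open>auto simp: X_def S_def\<close>)+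
  have va: "valency D a + chi A \<le> card A"
  proof (rule valency_budget[where P = P1 and Q = Qa and j = 2])
    have "valency D2 a = 0" using D2(4) Y A E_commute by blast
    then show "valency D a + chi P1 + chi Qa \<le> card P1 + card Qa + 2"
      using val[of a] D1(5) by linarith
    show "chi (A - P1 - Qa) + 2 \<le> card (A - P1 - Qa)"
      by (rule cnt(12)) (use A in \<open>auto simp: P1_def Qa_def X_def S_def\<close>)
  qed (use A(1) subs in \<open>auto simp: P1_def Qa_def\<close>)
  have vd: "valency D d + chi A \<le> card A"
  proof (rule valency_budget[where P = P2 and Q = Qd and j = 2])
    show "valency D d + chi P2 + chi Qd \<le> card P2 + card Qd + 2"
      using val[of d] D2(6) out1 by linarith
    show "chi (A - P2 - Qd) + 2 \<le> card (A - P2 - Qd)"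
      by (rule cnt(12)) (use A in \<open>auto simp: P2_def Qd_def Y_def E_commute\<close>)
  qed (use A(1) subs in \<open>auto simp: P2_def Qd_def\<close>)
  have vb: "valency D b + chi A \<le> card A"
  proof (cases "E b c")
    case False
    show ?thesis
    proof (rule valency_budget[where P = P1 and Q = Qb and j = 2])
      have "valency D2 b = 0" using D2(4) Y A(6) False E_commute by blast
      then show "valency D b + chi P1 + chi Qb \<le> card P1 + card Qb + 2"
        using val[of b] D1(6) by linarith
      show "chi (A - P1 - Qb) + 2 \<le> card (A - P1 - Qb)"
        by (rule cnt(12)) (use A in \<open>auto simp: P1_def Qb_def X_def S_def\<close>)
    qed (use A(1) subs in \<open>auto simp: P1_def Qb_def\<close>)
  next
    case True
    then obtain y z where yz: "y \<in> A" "z \<in> A" "y \<noteq> z" "y \<noteq> b" "z \<noteq> b" "indep {b, y, z}"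
      using bc by blast
    have nyz: "\<not> E b y" "\<not> E b z" using yz(6) by (auto simp: indep_def)
    then have ac: "y \<noteq> a" "z \<noteq> a" "y \<noteq> c" "z \<noteq> c" using True A(3) sym by blast+
    show ?thesis
    proof (rule valency_budget[where P = P1 and Q = Qb and j = 3])
      have "valency D2 b \<le> 1" using D2(3) Y by blast
      then show "valency D b + chi P1 + chi Qb \<le> card P1 + card Qb + 3"
        using val[of b] D1(6) by linarith
      have "chi (A - P1 - Qb) + card {a, c} + card {b, y, z} \<le> card (A - P1 - Qb) + 2"
      proof (rule chi_two_indep[OF _ _ _ _ cnt(10) yz(6)])
        show "{a, c} \<inter> {b, y, z} = {}" using ac ne by auto
        show "{b, y, z} \<subseteq> A - P1 - Qb" using nyz yz A(2) by (auto simp: P1_def Qb_def irrefl)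
      qed (use A in \<open>auto simp: P1_def Qb_def X_def S_def\<close>)
      then show "chi (A - P1 - Qb) + 3 \<le> card (A - P1 - Qb)" using ne yz by simp
    qed (use A(1) subs in \<open>auto simp: P1_def Qb_def\<close>)
  qed
  have vc: "valency D c + chi A \<le> card A"
  proof (cases "E b c")
    case False
    show ?thesis
    proof (rule valency_budget[where P = P2 and Q = Qc and j = 2])
      show "valency D c + chi P2 + chi Qc \<le> card P2 + card Qc + 2"
        using val[of c] D2(5) out1 by linarith
      show "chi (A - P2 - Qc) + 2 \<le> card (A - P2 - Qc)"
        by (rule cnt(12)) (use A False in \<open>auto simp: P2_def Qc_def Y_def E_commute\<close>)
    qed (use A(1) subs in \<open>auto simp: P2_def Qc_def\<close>)
  next
    case True
    have bQ: "b \<in> Qc" using True A(6) Y E_commute by (auto simp: Qc_def)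
    have dQ: "d \<notin> Qc" by (auto simp: Qc_def Y_def)
    have finQ: "finite Qc" using fin by (simp add: Qc_def)
    \<comment> \<open>Now \<open>b\<close> is a neighbour of \<open>c\<close>, so the pair \<open>{b, d}\<close> is not available as a colour class
      outside the neighbourhood of \<open>c\<close>. Instead, \<open>d\<close> takes a colour of \<open>Qc\<close>, none of whose vertices is
      adjacent to \<open>d\<close>.\<close>
    show ?thesis
    proof (rule valency_budget[where P = P2 and Q = "insert d Qc" and j = 1])
      have "chi (insert d Qc) \<le> chi Qc"
        by (rule chi_insert_nonneighbours[OF finQ bQ]) (auto simp: Qc_def)
      then show "valency D c + chi P2 + chi (insert d Qc) \<le> card P2 + card (insert d Qc) + 1"
        using val[of c] D2(5) out1 dQ finQ by simp
      have "chi (A - P2 - insert d Qc) + card {a, c} \<le> card (A - P2 - insert d Qc) + 1"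
        by (rule chi_one_indep[OF _ _ cnt(10)])
          (use A ne in \<open>auto simp: P2_def Qc_def Y_def E_commute irrefl\<close>)
      then show "chi (A - P2 - insert d Qc) + 1 \<le> card (A - P2 - insert d Qc)"
        using ne by simp
    qed (use A subs in \<open>auto simp: P2_def Qc_def Y_def\<close>)
  qed
  have "good_cover A (C \<union> D)"
  proof (rule good_cover_extend[where S = S and k = 2])
    show "S \<subseteq> A" using A by (simp add: S_def)
    show "good_cover (A - S) C" using C by (simp add: S_def)
    have "X \<union> {a, b} \<subseteq> A" "Y \<union> {c, d} = A" using A(2) by (auto simp: X_def Y_def)
    then show "\<forall>K\<in>D. K \<subseteq> A \<and> complete K" using D1(1) D2(1) unfolding D_def by blast
    show "\<forall>s\<in>S. \<forall>u\<in>A. E s u \<longrightarrow> (\<exists>K\<in>D. s \<in> K \<and> u \<in> K)"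
    proof (intro ballI impI)
      fix s u assume su: "s \<in> S" "u \<in> A" "E s u"
      have uY: "u \<in> Y \<union> {c, d}" using su by (auto simp: Y_def)
      consider "s \<in> {c, d}" | "s \<in> {a, b}" "u \<in> {c, d}" | "s \<in> {a, b}" "u \<in> X \<union> {a, b}"
        using su Y by (auto simp: S_def Y_def)
      then show "\<exists>K\<in>D. s \<in> K \<and> u \<in> K"
      proof cases
        case 1
        then show ?thesis using D2(2) uY su(3) unfolding D_def by blast
      next
        case 2
        then have "\<exists>K\<in>D2. u \<in> K \<and> s \<in> K" using D2(2) Y sym[OF su(3)] by blast
        then show ?thesis unfolding D_def by blast
      next
        case 3
        then show ?thesis using D1(2) su(3) unfolding D_def by blast
      qed
    qed
    show "chi A + 2 \<le> chi (A - S) + card S" "card A = card (A - S) + card S"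
      using cnt(8,9) by (simp_all only: S_def)
    show "\<forall>s\<in>S. valency D s + chi A \<le> card A" using va vb vc vd by (simp add: S_def)
    show "\<forall>x\<in>A - S. valency D x \<le> 2"
    proof
      fix x assume "x \<in> A - S"
      then have "valency D1 x \<le> 1" "valency D2 x \<le> 1" using D1(3) D2(3) Y by (auto simp: X_def)
      then show "valency D x \<le> 2" using val[of x] by linarith
    qed
    show "\<forall>x\<in>A - S. universal_in (A - S) x \<longrightarrow> \<not> universal_in A x \<longrightarrow> valency D x < 2"
    proof (intro ballI impI)
      fix x assume x: "x \<in> A - S" "universal_in (A - S) x" "\<not> universal_in A x"
      have xX: "x \<in> X" "x \<in> Y" using x(1) Y by (auto simp: X_def)
      have le: "valency D1 x \<le> 1" "valency D2 x \<le> 1" using D1(3) D2(3) xX by auto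
      have "(\<not> E a x \<and> \<not> E b x) \<or> (\<not> E c x \<and> \<not> E d x)"
        using missed_edge[OF und A(2,5,6,7)] x bc unfolding S_def E_commute[of _ x] by blast
      then have "valency D1 x = 0 \<or> valency D2 x = 0"
        using D1(4) D2(4) xX by auto
      then show "valency D x < 2" using val[of x] le by linarith
    qed
  qed
  then show ?thesis by blast
qed

text \<open>Irreflexivity and the four non-edges make the vertices distinct.\<close>

definition induced_2K2_free :: "'a set \<Rightarrow> bool" where
  "induced_2K2_free A \<longleftrightarrow> \<not> (\<exists>a\<in>A. \<exists>b\<in>A. \<exists>c\<in>A. \<exists>d\<in>A.
    E a b \<and> E c d \<and> \<not> E a c \<and> \<not> E b d \<and> \<not> E a d \<and> \<not> E b c)"

definition independence_le_2 :: "'a set \<Rightarrow> bool" where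
  "independence_le_2 A \<longleftrightarrow> (\<forall>x\<in>A. \<forall>y\<in>A. \<forall>z\<in>A.
    x \<noteq> y \<longrightarrow> x \<noteq> z \<longrightarrow> y \<noteq> z \<longrightarrow> E x y \<or> E x z \<or> E y z)"

text \<open>
  Without independent triples, the neighbours of one end of an edge that are not adjacent to the
  other end form a clique, and likewise all non-neighbours of a vertex. If \<open>x\<close> is a neighbour of \<open>b\<close>
  but not of \<open>a\<close>, then \<open>x\<close> is adjacent to \<open>c\<close>, because \<open>a\<close>, \<open>c\<close>, \<open>x\<close> are not independent; the
  same holds with the roles of the two ends of the path exchanged. If such an \<open>x\<close> and a neighbour
  \<open>y\<close> of \<open>c\<close> but not of \<open>d\<close> were not adjacent, then \<open>ay\<close> and \<open>dx\<close> would be an induced \<open>2K\<^sub>2\<close>. Hence the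
  set \<open>M\<close> below is a clique. It covers the edge \<open>bc\<close> and serves \<open>b\<close> and \<open>c\<close> at the same time, so each
  of the four vertices pays for one Nordhaus--Gaddum partition and one additional clique.
\<close>

lemma add_path_independence_2:
  assumes A: "finite A" "{a, b, c, d} \<subseteq> A" "E a b" "E c d" "\<not> E a c" "\<not> E b d" "\<not> E a d"
    and bc: "E b c"
    and und: "undominated A" and alpha: "independence_le_2 A" and tef: "induced_2K2_free A"
    and C: "good_cover (A - {a, b, c, d}) C"
    and nomiss: "\<not> (\<exists>x. misses_exactly A b c x)"
  shows "\<exists>C'. good_cover A C'"
proof -
  define S where "S = {a, b, c, d}"
  note cnt = four_vertex_counts[OF A]
  note ne = cnt(2-7)
  have tri: "E x y" if "x \<in> A" "y \<in> A" "x \<noteq> y" "z \<in> A" "x \<noteq> z" "y \<noteq> z" "\<not> E z x" "\<not> E z y" for x y z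
    using alpha that E_commute unfolding independence_le_2_def by metis
  define X where "X = A - S"
  have XA: "x \<in> A" "x \<noteq> a" "x \<noteq> b" "x \<noteq> c" "x \<noteq> d" if "x \<in> X" for x
    using that by (auto simp: X_def S_def)
  have notX: "a \<notin> X" "b \<notin> X" "c \<notin> X" "d \<notin> X" by (auto simp: X_def S_def)
  have inA: "a \<in> A" "b \<in> A" "c \<in> A" "d \<in> A" using A(2) by auto
  define P1 where "P1 = {x\<in>X. E a x \<and> E b x}"
  define Qa where "Qa = {x\<in>X. E a x \<and> \<not> E b x}"
  define Qb where "Qb = {x\<in>X. E b x \<and> \<not> E a x}"
  define P2 where "P2 = {x\<in>X. E c x \<and> E d x}"
  define Qc where "Qc = {x\<in>X. E c x \<and> \<not> E d x}"
  define Qd where "Qd = {x\<in>X. E d x \<and> \<not> E c x}"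
  define M where "M = Qb \<union> Qc \<union> {b, c}"
  obtain D1 where D1: "\<forall>K\<in>D1. K \<subseteq> P1 \<union> {a, b} \<and> complete K"
    "\<forall>x\<in>P1 \<union> {a, b}. \<forall>t\<in>{a, b}. \<exists>K\<in>D1. x \<in> K \<and> t \<in> K"
    "\<forall>x\<in>P1. valency D1 x \<le> 1" "\<forall>x. x \<notin> P1 \<union> {a, b} \<longrightarrow> valency D1 x = 0"
    "\<forall>x. valency D1 x + chi P1 \<le> card P1 + 1"
    by (rule star_family[of P1 "{a, b}"])
      (use A in \<open>auto simp: P1_def X_def S_def complete_def E_commute\<close>)
  obtain D2 where D2: "\<forall>K\<in>D2. K \<subseteq> P2 \<union> {c, d} \<and> complete K"
    "\<forall>x\<in>P2 \<union> {c, d}. \<forall>t\<in>{c, d}. \<exists>K\<in>D2. x \<in> K \<and> t \<in> K"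
    "\<forall>x\<in>P2. valency D2 x \<le> 1" "\<forall>x. x \<notin> P2 \<union> {c, d} \<longrightarrow> valency D2 x = 0"
    "\<forall>x. valency D2 x + chi P2 \<le> card P2 + 1"
    by (rule star_family[of P2 "{c, d}"])
      (use A in \<open>auto simp: P2_def X_def S_def complete_def E_commute\<close>)
  define D where "D = D1 \<union> (D2 \<union> {M, insert a Qa, insert d Qd})"
  have val: "valency D x \<le> valency D1 x + valency D2 x + (if x \<in> M then 1 else 0)
      + (if x \<in> insert a Qa then 1 else 0) + (if x \<in> insert d Qd then 1 else 0)" for x
    using valency_Un_le[of D1 "D2 \<union> {M, insert a Qa, insert d Qd}" x]
      valency_Un_le[of D2 "{M, insert a Qa, insert d Qd}" x]
      valency_insert_le[of M "{insert a Qa, insert d Qd}" x]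
      valency_insert_le[of "insert a Qa" "{insert d Qd}" x]
      valency_insert_le[of "insert d Qd" "{}" x]
    unfolding D_def valency_empty by linarith
  have bQ: "E c x" if "x \<in> Qb" for x
  proof -
    have "x \<in> X" "\<not> E a x" using that by (auto simp: Qb_def)
    then show ?thesis using tri[of c x a] XA[of x] inA ne A(5) by auto
  qed
  have cQ: "E b x" if "x \<in> Qc" for x
  proof -
    have "x \<in> X" "\<not> E d x" using that by (auto simp: Qc_def)
    moreover have "\<not> E d b" using A(6) E_commute by blast
    ultimately show ?thesis using tri[of b x d] XA[of x] inA ne by auto
  qed
  have cross: "E x y" if x: "x \<in> Qb" and y: "y \<in> Qc" and xy: "x \<noteq> y" for x y
  proof (rule ccontr)
    assume n: "\<not> E x y"
    have xX: "x \<in> X" "\<not> E a x" and yX: "y \<in> X" "\<not> E d y" using x y by (auto simp: Qb_def Qc_def)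
    have nda: "\<not> E d a" using A(7) E_commute by blast
    have "E d x" using tri[of d x a] xX XA[of x] inA ne A(7) by auto
    moreover have "E a y" using tri[of a y d] yX XA[of y] inA ne nda by auto
    moreover have "\<not> E x a" "\<not> E y d" "\<not> E x y" "\<not> E y x" using xX yX n E_commute by blast+
    ultimately show False
      using tef nda xX yX XA[of x] XA[of y] inA unfolding induced_2K2_free_def by blast
  qed
  have Qb_complete: "E x y" if "x \<in> Qb" "y \<in> Qb" "x \<noteq> y" for x y
    using that tri[of x y a] XA[of x] XA[of y] inA by (auto simp: Qb_def)
  have Qc_complete: "E x y" if "x \<in> Qc" "y \<in> Qc" "x \<noteq> y" for x y
    using that tri[of x y d] XA[of x] XA[of y] inA by (auto simp: Qc_def)
  have Qa_complete: "E x y" if "x \<in> Qa" "y \<in> Qa" "x \<noteq> y" for x y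
    using that tri[of x y b] XA[of x] XA[of y] inA by (auto simp: Qa_def)
  have Qd_complete: "E x y" if "x \<in> Qd" "y \<in> Qd" "x \<noteq> y" for x y
    using that tri[of x y c] XA[of x] XA[of y] inA by (auto simp: Qd_def)
  have M_complete: "complete M"
  proof -
    have "E b x" if "x \<in> Qb" for x using that unfolding Qb_def by blast
    moreover have "E c x" if "x \<in> Qc" for x using that unfolding Qc_def by blast
    ultimately have bc_M: "E b x" "E c x" if "x \<in> Qb \<union> Qc" for x
      using that bQ cQ by blast+
    have "E x y" if xy: "x \<in> M" "y \<in> M" "x \<noteq> y" for x y
    proof -
      consider "x \<in> {b, c}" "y \<in> {b, c}" | "x \<in> {b, c}" "y \<in> Qb \<union> Qc" | "y \<in> {b, c}" "x \<in> Qb \<union> Qc"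
        | "x \<in> Qb" "y \<in> Qb" | "x \<in> Qc" "y \<in> Qc" | "x \<in> Qb" "y \<in> Qc" | "x \<in> Qc" "y \<in> Qb"
        using xy unfolding M_def by blast
      then show ?thesis
      proof cases
        case 1 then show ?thesis using bc sym[OF bc] xy(3) by blast
      next
        case 2 then show ?thesis using bc_M by blast
      next
        case 3 then have "E y x" using bc_M by blast
        then show ?thesis by (rule sym)
      next
        case 7 then have "E y x" using cross xy(3) by blast
        then show ?thesis by (rule sym)
      qed (use Qb_complete Qc_complete cross xy(3) in blast)+
    qed
    then show ?thesis unfolding complete_def by blast
  qed
  have a_complete: "complete (insert a Qa)"
  proof -
    have "E a x" "E x a" if "x \<in> Qa" for x using that sym unfolding Qa_def by blast+
    then show ?thesis unfolding complete_def using Qa_complete by blast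
  qed
  have d_complete: "complete (insert d Qd)"
  proof -
    have "E d x" "E x d" if "x \<in> Qd" for x using that sym unfolding Qd_def by blast+
    then show ?thesis unfolding complete_def using Qd_complete by blast
  qed
  have outM: "a \<notin> M" "d \<notin> M" "b \<notin> insert a Qa" "c \<notin> insert a Qa" "d \<notin> insert a Qa"
    "a \<notin> insert d Qd" "b \<notin> insert d Qd" "c \<notin> insert d Qd"
    using ne notX by (auto simp: M_def Qa_def Qb_def Qc_def Qd_def)
  have outP: "a \<notin> P2 \<union> {c, d}" "b \<notin> P2 \<union> {c, d}" "c \<notin> P1 \<union> {a, b}" "d \<notin> P1 \<union> {a, b}"
    using ne notX by (auto simp: P1_def P2_def)
  have budget1: "v + chi A \<le> card A" if "v \<le> valency D1 s + 1" for v s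
  proof (rule valency_budget[where P = P1 and Q = "{}" and j = 2])
    show "v + chi P1 + chi {} \<le> card P1 + card {} + 2"
      using D1(5)[rule_format, of s] that chi_le_card[of "{}"] by simp
    have "chi (A - P1) + 2 \<le> card (A - P1)"
      by (rule cnt(12)) (use A in \<open>auto simp: P1_def X_def S_def\<close>)
    then show "chi (A - P1 - {}) + 2 \<le> card (A - P1 - {})" by simp
  qed (use A(1) in \<open>auto simp: P1_def X_def\<close>)
  have budget2: "v + chi A \<le> card A" if "v \<le> valency D2 s + 1" for v s
  proof (rule valency_budget[where P = P2 and Q = "{}" and j = 2])
    show "v + chi P2 + chi {} \<le> card P2 + card {} + 2"
      using D2(5)[rule_format, of s] that chi_le_card[of "{}"] by simp
    have "chi (A - P2) + 2 \<le> card (A - P2)"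
      by (rule cnt(12)) (use A in \<open>auto simp: P2_def X_def S_def\<close>)
    then show "chi (A - P2 - {}) + 2 \<le> card (A - P2 - {})" by simp
  qed (use A(1) in \<open>auto simp: P2_def X_def\<close>)
  have "good_cover A (C \<union> D)"
  proof (rule good_cover_extend[where S = S and k = 2])
    show "S \<subseteq> A" using A by (simp add: S_def)
    show "good_cover (A - S) C" using C by (simp add: S_def)
    have sub: "P1 \<union> {a, b} \<subseteq> A" "P2 \<union> {c, d} \<subseteq> A" "M \<subseteq> A" "insert a Qa \<subseteq> A" "insert d Qd \<subseteq> A"
      using inA XA by (auto simp: P1_def P2_def M_def Qa_def Qb_def Qc_def Qd_def)
    show "\<forall>K\<in>D. K \<subseteq> A \<and> complete K"
    proof
      fix K assume "K \<in> D"
      then consider "K \<in> D1" | "K \<in> D2" | "K = M" | "K = insert a Qa" | "K = insert d Qd"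
        unfolding D_def by blast
      then show "K \<subseteq> A \<and> complete K"
      proof cases
        case 1 then show ?thesis using D1(1) sub(1) by (meson order_trans)
      next
        case 2 then show ?thesis using D2(1) sub(2) by (meson order_trans)
      qed (simp_all only: sub M_complete a_complete d_complete simp_thms)
    qed
    show "\<forall>s\<in>S. \<forall>u\<in>A. E s u \<longrightarrow> (\<exists>K\<in>D. s \<in> K \<and> u \<in> K)"
    proof (intro ballI impI)
      fix s u assume su: "s \<in> S" "u \<in> A" "E s u"
      have nE: "\<not> E c a" "\<not> E d b" "\<not> E d a" using A(5-7) E_commute by blast+
      consider "s \<in> {a, b}" "u \<in> P1 \<union> {a, b}" | "s \<in> {c, d}" "u \<in> P2 \<union> {c, d}"
        | "s \<in> M" "u \<in> M" | "s = a" "u \<in> Qa" | "s = d" "u \<in> Qd"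
      proof (cases "u \<in> X")
        case True
        consider "s = a" | "s = b" | "s = c" | "s = d" using su(1) by (auto simp: S_def)
        then show ?thesis
        proof cases
          case 1 then show ?thesis using that(1,4) True su(3) by (auto simp: P1_def Qa_def)
        next
          case 2 then show ?thesis using that(1,3) True su(3) by (auto simp: P1_def Qb_def M_def)
        next
          case 3 then show ?thesis using that(2,3) True su(3) by (auto simp: P2_def Qc_def M_def)
        next
          case 4 then show ?thesis using that(2,5) True su(3) by (auto simp: P2_def Qd_def)
        qed
      next
        case False
        then have "u \<in> {a, b, c, d}" using su(2) by (auto simp: X_def S_def)
        moreover have "s \<in> {a, b, c, d}" using su(1) by (simp add: S_def)
        ultimately show ?thesis using that(1-3) su(3) nE A(5-7) by (auto simp: M_def)
      qed
      then show "\<exists>K\<in>D. s \<in> K \<and> u \<in> K"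
      proof cases
        case 1
        then have "\<exists>K\<in>D1. u \<in> K \<and> s \<in> K" using D1(2) by blast
        then show ?thesis unfolding D_def by blast
      next
        case 2
        then have "\<exists>K\<in>D2. u \<in> K \<and> s \<in> K" using D2(2) by blast
        then show ?thesis unfolding D_def by blast
      qed (auto simp: D_def)
    qed
    show "chi A + 2 \<le> chi (A - S) + card S" "card A = card (A - S) + card S"
      using cnt(8,9) by (simp_all only: S_def)
    have "valency D a \<le> valency D1 a + 1" "valency D b \<le> valency D1 b + 1"
      "valency D c \<le> valency D2 c + 1" "valency D d \<le> valency D2 d + 1"
      using val[of a] val[of b] val[of c] val[of d] outM outP D1(4) D2(4)
      by (simp_all split: if_splits)
    then show "\<forall>s\<in>S. valency D s + chi A \<le> card A"
      using budget1 budget2 by (simp add: S_def)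
    have outside: "valency D x \<le> 2 \<and> ((\<not> E a x \<and> \<not> E b x) \<or> (\<not> E c x \<and> \<not> E d x) \<longrightarrow> valency D x < 2)"
      if x: "x \<in> X" for x
    proof -
      have t: "x \<notin> {a, b}" "x \<notin> {c, d}" using XA x by auto
      have v1: "valency D1 x \<le> (if x \<in> P1 then 1 else 0)" using D1(3,4) t by auto
      have v2: "valency D2 x \<le> (if x \<in> P2 then 1 else 0)" using D2(3,4) t by auto
      have "valency D x \<le> (if x \<in> P1 then 1 else 0) + (if x \<in> P2 then 1 else 0)
        + (if x \<in> Qb \<union> Qc then 1 else 0) + (if x \<in> Qa then 1 else 0) + (if x \<in> Qd then 1 else 0)"
        using val[of x] v1 v2 t by (auto simp: M_def)
      then show ?thesis using x
        by (auto simp: P1_def P2_def Qa_def Qb_def Qc_def Qd_def split: if_splits)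
    qed
    then show "\<forall>x\<in>A - S. valency D x \<le> 2" unfolding X_def by blast
    show "\<forall>x\<in>A - S. universal_in (A - S) x \<longrightarrow> \<not> universal_in A x \<longrightarrow> valency D x < 2"
    proof (intro ballI impI)
      fix x assume x: "x \<in> A - S" "universal_in (A - S) x" "\<not> universal_in A x"
      have "(\<not> E a x \<and> \<not> E b x) \<or> (\<not> E c x \<and> \<not> E d x)"
        using missed_edge[OF und A(2,5,6,7)] x nomiss unfolding S_def E_commute[of _ x] by blast
      then show "valency D x < 2" using outside x(1) unfolding X_def by blast
    qed
  qed
  then show ?thesis by blast
qed

section \<open>A five-cycle joined to all other vertices\<close>

text \<open>
  Here \<open>x\<close> is universal after the deletion of \<open>a, b, c, d\<close>, but not before, and so it can afford only one
  new clique, although both \<open>xa\<close> and \<open>xd\<close> have to be covered. The way out is to insert \<open>a\<close> into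
  a clique \<open>L\<close> of the old cover that contains \<open>x\<close>. This is possible since \<open>a\<close> is adjacent to \<open>x\<close> and to
  everything outside the five-cycle. Only \<open>xd\<close> then needs a new clique.
\<close>

lemma add_five_cycle:
  assumes fin: "finite A" and sub: "{a, b, c, d, x} \<subseteq> A"
    and e: "E a b" "E b c" "E c d" "E d x" "E x a"
    and n: "\<not> E a c" "\<not> E a d" "\<not> E b d" "\<not> E b x" "\<not> E c x"
    and joined: "\<forall>y\<in>A - {a, b, c, d, x}. \<forall>s\<in>{a, b, c, d, x}. E y s"
    and C: "good_cover (A - {a, b, c, d}) C"
  shows "\<exists>C'. good_cover A C'"
proof -
  define S where "S = {a, b, c, d}"
  have S: "{a, b, c, d} \<subseteq> A" using sub by auto
  note cnt = four_vertex_counts[OF fin S e(1,3) n(1,3,2)]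
  note ne = cnt(2-7)
  have "x \<noteq> a" "x \<noteq> b" "x \<noteq> c" "x \<noteq> d" using e n irrefl sym by metis+
  note ne = ne this
  define R where "R = A - {a, b, c, d, x}"
  have AS: "A - S = insert x R" using sub ne by (auto simp: S_def R_def)
  have notR: "a \<notin> R" "b \<notin> R" "c \<notin> R" "d \<notin> R" "x \<notin> R" by (auto simp: R_def)
  have finR: "finite R" using fin by (simp add: R_def)
  have joinR: "E y s" "E s y" if "y \<in> R" "s \<in> {a, b, c, d, x}" for y s
  proof -
    show "E y s" using joined that unfolding R_def by blast
    then show "E s y" by (rule sym)
  qed
  have chiA: "chi A \<le> chi (insert x R) + 2" and cardA: "card A = card (insert x R) + 4"
    using cnt(1,8,9) AS unfolding S_def by simp_all
  have univ_x: "universal_in (insert x R) x" using joinR by (auto simp: universal_in_def)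
  \<comment> \<open>If no clique of the given cover contains \<open>x\<close>, the clique \<open>{x}\<close> may be added to it: the
    bound for the universal vertex \<open>x\<close> is at least one.\<close>
  obtain C0 L where C0: "good_cover (insert x R) C0" and L: "L \<in> C0" "x \<in> L"
  proof (cases "\<exists>K\<in>C. x \<in> K")
    case True
    then show ?thesis using that C AS unfolding S_def by auto
  next
    case False
    have Cg: "good_cover (insert x R) C" using C AS unfolding S_def by simp
    have "clique_cover (insert x R) (insert {x} C)"
      using Cg unfolding good_cover_def clique_cover_def by (auto simp: complete_def)
    moreover have "valency (insert {x} C) v + chi (insert x R)
        \<le> card (insert x R) + (if universal_in (insert x R) v then 1 else 0)" if v: "v \<in> insert x R" for v
    proof (cases "v = x")
      case True
      have "valency C x = 0" using False by (intro valency_eq_0) blast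
      then have "valency (insert {x} C) v \<le> 1"
        using valency_insert_le[of "{x}" C x] True by simp
      then show ?thesis using chi_le_card[of "insert x R"] finR True univ_x by simp
    next
      case False
      then have "valency (insert {x} C) v \<le> valency C v"
        using valency_insert_le[of "{x}" C v] by simp
      moreover have "valency C v + chi (insert x R)
        \<le> card (insert x R) + (if universal_in (insert x R) v then 1 else 0)"
        using Cg v unfolding good_cover_def by blast
      ultimately show ?thesis by linarith
    qed
    ultimately have "good_cover (insert x R) (insert {x} C)" unfolding good_cover_def by blast
    then show ?thesis using that by blast
  qed
  have C0cl: "K \<subseteq> insert x R" "complete K" if "K \<in> C0" for K
    using C0 that unfolding good_cover_def clique_cover_def by blast+
  have C0cov: "\<exists>K\<in>C0. u \<in> K \<and> v \<in> K" if "u \<in> insert x R" "v \<in> insert x R" "E u v" for u v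
    using C0 that unfolding good_cover_def clique_cover_def by blast
  have C0val: "valency C0 v + chi (insert x R)
      \<le> card (insert x R) + (if universal_in (insert x R) v then 1 else 0)" if "v \<in> insert x R" for v
    using C0 that unfolding good_cover_def by blast
  have "C0 \<subseteq> Pow (insert x R)" using C0cl by blast
  then have finC0: "finite C0" using finR by (simp add: finite_subset)
  define g where "g K = (if K = L then insert a K else K)" for K
  have g_sup: "K \<subseteq> g K" for K by (auto simp: g_def)
  obtain D1 where D1: "\<forall>K\<in>D1. K \<subseteq> R \<union> {a, b} \<and> complete K"
    "\<forall>x\<in>R \<union> {a, b}. \<forall>t\<in>{a, b}. \<exists>K\<in>D1. x \<in> K \<and> t \<in> K"
    "\<forall>x\<in>R. valency D1 x \<le> 1" "\<forall>x. x \<notin> R \<union> {a, b} \<longrightarrow> valency D1 x = 0"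
    "\<forall>x. valency D1 x + chi R \<le> card R + 1"
    by (rule star_family[of R "{a, b}"])
      (use finR e(1) notR joinR in \<open>auto simp: complete_def intro: sym\<close>)
  obtain D2 where D2: "\<forall>K\<in>D2. K \<subseteq> R \<union> {c, d} \<and> complete K"
    "\<forall>x\<in>R \<union> {c, d}. \<forall>t\<in>{c, d}. \<exists>K\<in>D2. x \<in> K \<and> t \<in> K"
    "\<forall>x\<in>R. valency D2 x \<le> 1" "\<forall>x. x \<notin> R \<union> {c, d} \<longrightarrow> valency D2 x = 0"
    "\<forall>x. valency D2 x + chi R \<le> card R + 1"
    by (rule star_family[of R "{c, d}"])
      (use finR e(3) notR joinR in \<open>auto simp: complete_def intro: sym\<close>)
  define F where "F = g ` C0 \<union> (D1 \<union> (D2 \<union> {{b, c}, {d, x}}))"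
  have val: "valency F v \<le> valency (g ` C0) v + valency D1 v + valency D2 v
      + (if v \<in> {b, c} then 1 else 0) + (if v \<in> {d, x} then 1 else 0)" for v
    using valency_Un_le[of "g ` C0" "D1 \<union> (D2 \<union> {{b, c}, {d, x}})" v]
      valency_Un_le[of D1 "D2 \<union> {{b, c}, {d, x}}" v]
      valency_Un_le[of D2 "{{b, c}, {d, x}}" v]
      valency_insert_le[of "{b, c}" "{{d, x}}" v] valency_insert_le[of "{d, x}" "{}" v]
    unfolding F_def valency_empty by linarith
  have valg: "valency (g ` C0) v \<le> valency C0 v" if "v \<noteq> a" for v
    by (rule valency_image_le[OF finC0]) (use that in \<open>auto simp: g_def split: if_splits\<close>)
  have valg0: "valency (g ` C0) v = 0" if "v \<in> {b, c, d}" for v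
  proof (rule valency_eq_0)
    fix K assume "K \<in> g ` C0"
    then have "K \<subseteq> insert a (insert x R)" using C0cl(1) by (auto simp: g_def split: if_splits)
    then show "v \<notin> K" using that ne notR by auto
  qed
  have valga: "valency (g ` C0) a \<le> 1"
  proof -
    have "{K \<in> g ` C0. a \<in> K} \<subseteq> {insert a L}"
      using C0cl(1) ne notR by (auto simp: g_def split: if_splits)
    then show ?thesis unfolding valency_def using card_mono[of "{insert a L}"] by fastforce
  qed
  have budget: "v + chi A \<le> card A" if "v + chi R \<le> card R + 2" for v
  proof (rule valency_budget[where P = R and Q = "{}" and j = 2])
    show "v + chi R + chi {} \<le> card R + card {} + 2"
      using that chi_le_card[of "{}"] by simp
    have "chi (A - R) + 2 \<le> card (A - R)"
      by (rule cnt(12)) (use fin S notR in auto)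
    then show "chi (A - R - {}) + 2 \<le> card (A - R - {})" by simp
  qed (use fin in \<open>auto simp: R_def\<close>)
  have cliques: "K \<subseteq> A \<and> complete K" if K: "K \<in> F" for K
  proof -
    have RA: "R \<union> {a, b} \<subseteq> A" "R \<union> {c, d} \<subseteq> A" "insert x R \<subseteq> A" "a \<in> A" "b \<in> A" "c \<in> A" "d \<in> A"
      using sub by (auto simp: R_def)
    consider K0 where "K0 \<in> C0" "K = g K0" | "K \<in> D1" | "K \<in> D2" | "K = {b, c}" | "K = {d, x}"
      using K unfolding F_def by blast
    then show ?thesis
    proof cases
      case 1
      have K0: "K0 \<subseteq> insert x R" "complete K0" using C0cl 1(1) by auto
      have "E a y" "E y a" if "y \<in> K0" for y
        using that K0(1) joinR[of y a] e(5) sym[OF e(5)] by auto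
      then have "complete (insert a K0)" using K0(2) unfolding complete_def by blast
      then have "complete K" using K0(2) 1(2) by (cases "K0 = L") (simp_all add: g_def)
      moreover have "K \<subseteq> A" using K0(1) RA 1(2) by (auto simp: g_def)
      ultimately show ?thesis by blast
    next
      case 2 then show ?thesis using D1(1) RA(1) by (meson order_trans)
    next
      case 3 then show ?thesis using D2(1) RA(2) by (meson order_trans)
    next
      case 4 then show ?thesis using RA e(2) sym[OF e(2)] by (auto simp: complete_def)
    next
      case 5 then show ?thesis using sub e(4) sym[OF e(4)] by (auto simp: complete_def)
    qed
  qed
  have cov1: "\<exists>K\<in>F. u \<in> K \<and> v \<in> K" if uv: "u \<in> S" "v \<in> A" "E u v" for u v
  proof -
    have nE: "\<not> E c a" "\<not> E d a" "\<not> E d b" using n E_commute by blast+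
    consider "u \<in> {a, b}" "v \<in> R \<union> {a, b}" | "u \<in> {c, d}" "v \<in> R \<union> {c, d}"
      | "u \<in> {b, c}" "v \<in> {b, c}" | "u \<in> {d, x}" "v \<in> {d, x}" | "u = a" "v = x"
      using uv n nE unfolding S_def R_def by blast
    then show ?thesis
    proof cases
      case 1
      then have "\<exists>K\<in>D1. v \<in> K \<and> u \<in> K" using D1(2) by blast
      then show ?thesis unfolding F_def by blast
    next
      case 2
      then have "\<exists>K\<in>D2. v \<in> K \<and> u \<in> K" using D2(2) by blast
      then show ?thesis unfolding F_def by blast
    next
      case 3
      then show ?thesis unfolding F_def by blast
    next
      case 4
      then show ?thesis unfolding F_def by blast
    next
      case 5
      have "a \<in> g L" "x \<in> g L" "g L \<in> F" using L by (auto simp: g_def F_def)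
      then show ?thesis using 5 by blast
    qed
  qed
  have cover: "\<exists>K\<in>F. u \<in> K \<and> v \<in> K" if uv: "u \<in> A" "v \<in> A" "E u v" for u v
  proof -
    consider "u \<in> S" | "v \<in> S" | "u \<in> insert x R" "v \<in> insert x R" using uv AS by blast
    then show ?thesis
    proof cases
      case 1
      then show ?thesis using cov1 uv by blast
    next
      case 2
      then show ?thesis using cov1[of v u] uv(1) sym[OF uv(3)] by blast
    next
      case 3
      then obtain K where "K \<in> C0" "u \<in> K" "v \<in> K" using C0cov uv(3) by blast
      then have "g K \<in> F" "u \<in> g K" "v \<in> g K" using g_sup[of K] by (auto simp: F_def)
      then show ?thesis by blast
    qed
  qed
  have "valency F v + chi A \<le> card A + (if universal_in A v then 1 else 0)" if v: "v \<in> A" for v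
  proof -
    consider "v \<in> S" | "v = x" | "v \<in> R" using v AS by blast
    then show ?thesis
    proof cases
      case 1
      have out: "valency D2 a = 0" "valency D2 b = 0" "valency D1 c = 0" "valency D1 d = 0"
        using D1(4) D2(4) ne notR by auto
      have "valency F v \<le> valency D1 v + 1 \<or> valency F v \<le> valency D2 v + 1"
        using 1 val[of v] valga valg0 out ne unfolding S_def by fastforce
      then have "valency F v + chi A \<le> card A"
        using budget[of "valency F v"] D1(5)[rule_format, of v] D2(5)[rule_format, of v] by linarith
      then show ?thesis by simp
    next
      case 2
      have "valency D1 x = 0" "valency D2 x = 0" using D1(4) D2(4) ne notR by auto
      then have "valency F x \<le> valency C0 x + 1" using val[of x] valg[of x] ne by auto
      then show ?thesis using C0val[of x] univ_x chiA cardA 2 by simp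
    next
      case 3
      have n3: "v \<noteq> a" "v \<notin> {b, c}" "v \<notin> {d, x}" using 3 notR by auto
      have "valency F v \<le> valency C0 v + 2"
        using val[of v] valg[OF n3(1)] D1(3)[rule_format, OF 3] D2(3)[rule_format, OF 3] n3 by simp
      moreover have "universal_in A v" if "universal_in (insert x R) v"
        using that joinR[OF 3] AS unfolding universal_in_def S_def by blast
      ultimately show ?thesis using C0val[of v] 3 chiA cardA by (auto split: if_splits)
    qed
  qed
  then have "good_cover A F"
    unfolding good_cover_def clique_cover_def using cliques cover by (intro conjI ballI impI) simp_all
  then show ?thesis by blast
qed

section \<open>Existence of good covers\<close>

text \<open>If \<open>y \<noteq> v\<close>, then \<open>y\<close> is adjacent to \<open>v\<close>, and the edges \<open>yv\<close> and \<open>pq\<close> form an induced \<open>2K\<^sub>2\<close>.\<close>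

lemma misses_exactly_unique:
  assumes "induced_2K2_free A" "p \<in> A" "q \<in> A" "v \<in> A" "E p q" "v \<noteq> p" "v \<noteq> q" "\<not> E v p" "\<not> E v q"
    and y: "misses_exactly A p q y"
  shows "y = v"
proof (rule ccontr)
  assume "y \<noteq> v"
  then have yv: "E y v" "\<not> E y p" "\<not> E y q" "y \<in> A"
    using y assms unfolding misses_exactly_def by metis+
  have "\<not> E p y" "\<not> E q v" "\<not> E p v" "\<not> E q y" using yv assms E_commute by blast+
  then show False using assms(1-5) yv unfolding induced_2K2_free_def by blast
qed

lemma good_cover_singleton:
  assumes "finite A" "complete A"
  shows "good_cover A {A}"
proof -
  have "valency {A} v + chi A \<le> card A + (if universal_in A v then 1 else 0)" if "v \<in> A" for v
  proof -
    have "universal_in A v" using assms(2) that by (auto simp: complete_def universal_in_def)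
    moreover have "valency {A} v \<le> 1" using valency_insert_le[of A "{}" v] that by simp
    ultimately show ?thesis using chi_le_card[OF assms(1)] by simp
  qed
  then show ?thesis using assms(2) unfolding good_cover_def clique_cover_def by blast
qed

text \<open>
  Assume that \<open>A\<close> has no good cover. Then none of the extension lemmas applies to \<open>A\<close>. So \<open>A\<close> has no
  dominated vertex, no induced \<open>2K\<^sub>2\<close>, and is not complete. In an independent triple \<open>u\<close>, \<open>w\<close>, \<open>z\<close>,
  the vertices \<open>u\<close>, \<open>w\<close> yield a path \<open>p u q w\<close>, and some \<open>x\<close> misses exactly \<open>u\<close> and \<open>q\<close>. Turning to the
  path \<open>q u p x\<close> of the resulting five-cycle, the vertex that misses exactly \<open>u\<close> and \<open>p\<close> would be
  \<open>w\<close>, but \<open>w\<close> also misses \<open>z\<close>. Without independent triples, every path of four vertices on such a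
  five-cycle must have a vertex that misses exactly its two inner vertices. It is always the fifth
  vertex of the cycle. So the cycle is joined to all other vertices.
\<close>

lemma good_cover_exists:
  assumes "finite A"
  shows "\<exists>C. good_cover A C"
  using assms
proof (induction A rule: finite_psubset_induct)
  case (psubset A)
  have IH: "\<exists>C. good_cover (A - S) C" if "S \<subseteq> A" "S \<noteq> {}" for S
    using psubset.IH[of "A - S"] that by blast
  have IH4: "\<exists>C. good_cover (A - {a, b, c, d}) C" if "{a, b, c, d} \<subseteq> A" for a b c d
    using IH[OF that] by blast
  show ?case
  proof (rule ccontr)
    assume none: "\<not> ?case"
    have und: "undominated A"
    proof (rule ccontr)
      assume "\<not> undominated A"
      then obtain u w where uw: "u \<in> A" "w \<in> A" "u \<noteq> w" "\<not> E u w" "\<forall>p\<in>A. E u p \<longrightarrow> E w p"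
        unfolding undominated_def by blast
      obtain C where "good_cover (A - {u}) C" using IH[of "{u}"] uw(1) by blast
      then show False using add_dominated_vertex[OF psubset.hyps uw] none by blast
    qed
    have step: "E b c \<and> ((\<forall>y\<in>A. \<forall>z\<in>A. y \<noteq> z \<longrightarrow> y \<noteq> b \<longrightarrow> z \<noteq> b \<longrightarrow> \<not> indep {b, y, z})
        \<or> (\<exists>x. misses_exactly A b c x))"
      if abcd: "{a, b, c, d} \<subseteq> A" "E a b" "E c d" "\<not> E a c" "\<not> E b d" "\<not> E a d" for a b c d
    proof -
      obtain C where "good_cover (A - {a, b, c, d}) C" using IH4[OF abcd(1)] by blast
      then show ?thesis using add_alternating_cycle[OF psubset.hyps abcd und] none by blast
    qed
    have tef: "induced_2K2_free A"
    proof (rule ccontr)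
      assume "\<not> induced_2K2_free A"
      then obtain a b c d where "{a, b, c, d} \<subseteq> A"
        "E a b" "E c d" "\<not> E a c" "\<not> E b d" "\<not> E a d" "\<not> E b c"
        unfolding induced_2K2_free_def by blast
      then show False using step[of a b c d] by blast
    qed
    \<comment> \<open>Undominatedness applied to \<open>u\<close>, \<open>w\<close> gives \<open>p\<close>; applied to \<open>w\<close>, \<open>p\<close> it gives \<open>q\<close>.\<close>
    have path: "\<exists>p\<in>A. \<exists>q\<in>A. E p u \<and> E q w \<and> \<not> E p q \<and> \<not> E p w"
      if uw: "u \<in> A" "w \<in> A" "u \<noteq> w" "\<not> E u w" for u w
    proof -
      obtain p where p: "p \<in> A" "E u p" "\<not> E w p" using und uw unfolding undominated_def by blast
      have "w \<noteq> p" using p(2) uw(4) by blast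
      then obtain q where q: "q \<in> A" "E w q" "\<not> E p q"
        using und uw(2) p unfolding undominated_def by blast
      show ?thesis using p q E_commute by metis
    qed
    show False
    proof (cases "independence_le_2 A")
      case False
      then obtain u w z where t: "u \<in> A" "w \<in> A" "z \<in> A" "u \<noteq> w" "u \<noteq> z" "w \<noteq> z"
        "\<not> E u w" "\<not> E u z" "\<not> E w z"
        unfolding independence_le_2_def by blast
      then have ind: "indep {u, w, z}" by (auto simp: indep_def irrefl E_commute)
      obtain p q where pq: "p \<in> A" "q \<in> A" "E p u" "E q w" "\<not> E p q" "\<not> E p w"
        using path[OF t(1,2,4,7)] by blast
      have "{p, u, q, w} \<subseteq> A" using t pq by blast
      then have "E u q" "\<exists>x. misses_exactly A u q x"
        using step[of p u q w] pq t ind by blast+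
      then obtain x where x: "misses_exactly A u q x" by blast
      have xx: "x \<in> A" "\<not> E x u" "\<not> E x q" using x by (auto simp: misses_exactly_def)
      have "x \<noteq> p" "p \<noteq> u" "p \<noteq> q" using xx(2) pq irrefl t(7) E_commute by metis+
      then have "E x p" using x pq(1) by (auto simp: misses_exactly_def)
      then have e: "E q u" "E p x" "\<not> E q p" "\<not> E u x" "\<not> E q x"
        using \<open>E u q\<close> pq(5) xx E_commute by blast+
      moreover have "{q, u, p, x} \<subseteq> A" using t pq xx by blast
      ultimately obtain y where y: "misses_exactly A u p y"
        using step[of q u p x] t ind by blast
      have wp: "w \<noteq> p" "\<not> E w u" "\<not> E w p" "E u p" "z \<noteq> p" using pq t E_commute by metis+
      have "y = w"
        by (rule misses_exactly_unique[OF tef t(1) pq(1) t(2) wp(4) _ wp(1) wp(2,3) y]) (use t in auto)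
      then show False using y t wp(5) by (auto simp: misses_exactly_def)
    next
      case True
      have missed: "\<exists>x. misses_exactly A b c x"
        if abcd: "{a, b, c, d} \<subseteq> A" "E a b" "E c d" "\<not> E a c" "\<not> E b d" "\<not> E a d" "E b c" for a b c d
      proof -
        obtain C where "good_cover (A - {a, b, c, d}) C" using IH4[OF abcd(1)] by blast
        then show ?thesis
          using add_path_independence_2[OF psubset.hyps abcd und True tef] none by blast
      qed
      have "\<not> complete A" using good_cover_singleton[OF psubset.hyps] none by blast
      then obtain b d where bd: "b \<in> A" "d \<in> A" "b \<noteq> d" "\<not> E b d" unfolding complete_def by blast
      obtain a c where ac: "a \<in> A" "c \<in> A" "E a b" "E c d" "\<not> E a c" "\<not> E a d"
        using path[OF bd] by blast
      have abcd: "{a, b, c, d} \<subseteq> A" using ac bd by blast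
      have bc: "E b c" using step[OF abcd ac(3,4,5) bd(4) ac(6)] by blast
      obtain x where x: "misses_exactly A b c x"
        using missed[OF abcd ac(3,4,5) bd(4) ac(6) bc] by blast
      have n: "\<not> E x b" "\<not> E x c" "\<not> E b x" "\<not> E c x" "\<not> E c a" "\<not> E d a" "\<not> E d b"
        using x ac bd E_commute unfolding misses_exactly_def by metis+
      have e: "E b a" "E d c" "E c b" using ac bc sym by blast+
      have ne: "a \<noteq> b" "a \<noteq> c" "a \<noteq> d" "b \<noteq> c" "c \<noteq> d" "x \<noteq> a" "x \<noteq> b" "x \<noteq> c" "x \<noteq> d"
        using n e ac bc bd irrefl x unfolding misses_exactly_def by metis+
      have xA: "x \<in> A" using x by (simp add: misses_exactly_def)
      have ex: "E x a" "E x d" using x ac bd ne unfolding misses_exactly_def by metis+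
      then have ex': "E a x" "E d x" using sym by blast+
      note U = misses_exactly_unique[OF tef]
      have "misses_exactly A c d a"
      proof -
        obtain y where y: "misses_exactly A c d y"
          using missed[of b c d x] abcd xA bc ex'(2) bd(4) n(4,3) ac(4) by blast
        then show ?thesis using U[of c d a y] ac bd ne by blast
      qed
      moreover have "misses_exactly A d x b"
      proof -
        obtain y where y: "misses_exactly A d x y"
          using missed[of c d x a] abcd xA ac(4) ex(1) n(4,6,5) ex'(2) by blast
        then show ?thesis using U[of d x b y] xA ac bd ne ex' n by blast
      qed
      moreover have "misses_exactly A x a c"
      proof -
        obtain y where y: "misses_exactly A x a y"
          using missed[of d x a b] abcd xA ex'(2) ac(3) n(6,1,7) ex(1) by blast
        then show ?thesis using U[of x a c y] xA ac bd ne ex n by blast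
      qed
      moreover have "misses_exactly A a b d"
      proof -
        obtain y where y: "misses_exactly A a b y"
          using missed[of x a b c] abcd xA ex(1) bc n(1) ac(5) n(2) ac(3) by blast
        then show ?thesis using U[of a b d y] xA ac bd ne ex n by blast
      qed
      ultimately have "\<forall>y\<in>A - {a, b, c, d, x}. \<forall>s\<in>{a, b, c, d, x}. E y s"
        using x E_commute unfolding misses_exactly_def by auto
      moreover obtain C where "good_cover (A - {a, b, c, d}) C" using IH4[OF abcd] by blast
      moreover have "{a, b, c, d, x} \<subseteq> A" using abcd xA by blast
      ultimately show False
        using add_five_cycle[OF psubset.hyps _ ac(3) bc ac(4) ex'(2) ex(1) ac(5,6) bd(4) n(3,4)] none
        by blast
    qed
  qed
qed

end

theorem theorem1p2:
  fixes G :: "('a, 'b) pre_digraph"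
  assumes "graph G"
  shows "\<exists>\<C>. edge_clique_cover G \<C> \<and>
    (\<forall>v\<in>verts G. int (valency \<C> v) \<le> (if universal_vertex G v then r G else r G - 1))"
proof -
  interpret graph G by (rule assms)
  interpret adjacency "\<lambda>u v. u \<rightarrow>\<^bsub>G\<^esub> v"
  proof
    fix u v
    show "v \<rightarrow>\<^bsub>G\<^esub> u" if "u \<rightarrow>\<^bsub>G\<^esub> v" using that sym_arcs by (metis symmetric_def symD)
    show "\<not> u \<rightarrow>\<^bsub>G\<^esub> u" using adj_not_same by blast
  qed
  have colourable_iff: "colourable (verts G) k \<longleftrightarrow> (\<exists>f. proper_colouring G k f)" for k
    unfolding colourable_def proper_colouring_def using adj_in_verts by blast
  have chi_eq: "chi (verts G) = chromatic_number G"
    unfolding chi_def chromatic_number_def colourable_iff ..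
  obtain C where C: "good_cover (verts G) C" using good_cover_exists finite_verts by blast
  have "edge_clique_cover G C"
    unfolding edge_clique_cover_def
  proof (intro conjI ballI allI impI)
    fix K assume "K \<in> C"
    then show "clique G K"
      using C unfolding good_cover_def clique_cover_def clique_def complete_def by simp
  next
    fix u v assume uv: "u \<rightarrow>\<^bsub>G\<^esub> v"
    then show "\<exists>K\<in>C. u \<in> K \<and> v \<in> K"
      using C adj_in_verts[OF uv] unfolding good_cover_def clique_cover_def by simp
  qed
  moreover have "int (valency C v) \<le> (if universal_vertex G v then r G else r G - 1)"
    if v: "v \<in> verts G" for v
  proof -
    have "universal_in (verts G) v = universal_vertex G v"
      using v by (simp add: universal_in_def universal_vertex_def)
    moreover have "valency C v + chromatic_number G
        \<le> card (verts G) + (if universal_in (verts G) v then 1 else 0)"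
      using C v unfolding good_cover_def chi_eq by blast
    ultimately show ?thesis unfolding r_def by (auto split: if_splits)
  qed
  ultimately show ?thesis by blast
qed

end
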